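(* Let $n>2$ be odd. Let $\zeta$ be a primitive $n$-th root of unity in $\bar{\mathbb{Q}}$. Let $c$ be a positive rational number such that $f=x^n-c$ is irreducible over $\mathbb{Q}$, and let $a=c^{1/n}$ be the positive real root of $f$. (1) A set $C=\{a\zeta^{b_i}\}_{i=1}^m$ (with $b_1,\dots,b_m$ integers) is a generating set for $f$ over $\mathbb{Q}$ if and only if $$\gcd(n,\,b_2-b_1,\,b_3-b_1,\,\dots,\,b_m-b_1)=1.$$ (2) For $0\le k<l\le n-1$, the set $B=\{a\zeta^k,a\zeta^l\}$ is a shortest minimal generating set for $f$ over $\mathbb{Q}$ if and only if $\gcd(l-k,n)=1$. Thus there are $n\phi(n)/2$ many shortest minimal generating sets for $f$ over $\mathbb{Q}$. (3) Suppose that for some $m>2$, a set $C=\{a\zeta^{b_i}\}_{i=1}^m$ of $m$ distinct roots is a minimal generating set for $f$ over $\mathbb{Q}$. Then $m\le\omega(n)$, where $\omega(n)$ is the number of distinct prime divisors of $n$. (4) If for some $m\geq 2$ we have $n=a_1a_2\cdots a_m$ where the $a_i$ are pairwise coprime integers greater than $1$, then $B=\{a\zeta^{n/a_i}\}_{i=1}^m$ is a minimal generating set for $f$ over $\mathbb{Q}$.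
   Context: $\phi$ is Euler's totient function. Let $\mathbb{Q}_f$ be the splitting field of $f$ over $\mathbb{Q}$. A set $C$ of roots of $f$ is a generating set for $f$ over $\mathbb{Q}$ if $\mathbb{Q}(C)=\mathbb{Q}_f$; it is a minimal generating set if moreover $\mathbb{Q}(A)\neq\mathbb{Q}_f$ for every $A\subsetneq C$; it is a shortest minimal generating set if it is a minimal generating set of least possible cardinality. *)

theory Defs
  imports
    Complex_Main
    "HOL-Algebra.Generated_Fields"
    "HOL-Algebra.Algebraic_Closure_Type"
    "HOL-Number_Theory.Totient"
begin

text \<open>
  All fields are subfields of the complex numbers. HOL-Algebra's polynomial, irreducibility and
  primality notions share names with those of HOL-Computational-Algebra; the latter are used here.
\<close>

definition rat_adjoin :: "complex set \<Rightarrow> complex set" where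
  "rat_adjoin S = generate_field ring_of_type_algebra (\<rat> \<union> S)"

definition complex_roots :: "rat Polynomial.poly \<Rightarrow> complex set" where
  "complex_roots f = {z. Polynomial.poly (map_poly of_rat f) z = 0}"

definition rat_splitting_field :: "rat Polynomial.poly \<Rightarrow> complex set" where
  "rat_splitting_field f = rat_adjoin (complex_roots f)"

definition generating_set :: "rat Polynomial.poly \<Rightarrow> complex set \<Rightarrow> bool" where
  "generating_set f C \<longleftrightarrow> C \<subseteq> complex_roots f \<and> rat_adjoin C = rat_splitting_field f"

definition minimal_generating_set :: "rat Polynomial.poly \<Rightarrow> complex set \<Rightarrow> bool" where
  "minimal_generating_set f C \<longleftrightarrow>
     generating_set f C \<and> (\<forall>A. A \<subset> C \<longrightarrow> rat_adjoin A \<noteq> rat_splitting_field f)"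

text \<open>For nonzero \<open>f\<close> all generating sets are finite, so \<open>card\<close> is the true cardinality.\<close>

definition shortest_minimal_generating_set :: "rat Polynomial.poly \<Rightarrow> complex set \<Rightarrow> bool" where
  "shortest_minimal_generating_set f C \<longleftrightarrow>
     minimal_generating_set f C \<and> (\<forall>D. minimal_generating_set f D \<longrightarrow> card C \<le> card D)"

definition primitive_root_of_unity :: "nat \<Rightarrow> complex \<Rightarrow> bool" where
  "primitive_root_of_unity n z \<longleftrightarrow> n > 0 \<and> z ^ n = 1 \<and> (\<forall>k. 0 < k \<and> k < n \<longrightarrow> z ^ k \<noteq> 1)"

end

theory Submission
  imports Defs "HOL-Number_Theory.Residues"
begin

text \<open>
  Everything reduces to one criterion: roots \<open>a \<zeta>\<^sup>b\<close> with \<open>b \<in> B\<close> generate the splitting field iff for no prime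
  \<open>p\<close> dividing \<open>n\<close> all exponents in \<open>B\<close> are congruent modulo \<open>p\<close>. If they are, all these roots lie in
  \<open>L(\<alpha>)\<close>, where \<open>\<alpha>\<close> is a root of \<open>f\<close> and \<open>L = \<rat>(\<zeta>\<^sup>p)\<close>. The powers \<open>1, \<alpha>, \<dots>, \<alpha>\<^sup>n\<^sup>-\<^sup>1\<close> are linearly
  independent over \<open>\<rat>(\<zeta>)\<close>, so \<open>\<zeta> \<in> L(\<alpha>)\<close> would force \<open>\<zeta> \<in> L\<close>, contradicting the irreducibility of the
  cyclotomic polynomial. The independence holds because a dependence puts a proper power of the real number
  \<open>a\<close> into \<open>\<rat>(\<zeta>)\<close>; its conjugates over \<open>\<rat>\<close> are all real, and since \<open>n\<close> is odd they coincide, so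
  it is rational, against the irreducibility of \<open>f\<close>. The four claims are then combinatorics of
  residues modulo the primes dividing \<open>n\<close>; in (3), removing a root from a minimal generating set makes the
  rest congruent modulo some prime, and distinct roots give distinct primes.
\<close>

subsection \<open>Subfields and simple extensions\<close>

definition subring_of :: "'a::field set \<Rightarrow> bool" where
  "subring_of K \<longleftrightarrow> 1 \<in> K \<and> (\<forall>x\<in>K. - x \<in> K) \<and> (\<forall>x\<in>K. \<forall>y\<in>K. x + y \<in> K \<and> x * y \<in> K)"

definition subfield_of :: "'a::field set \<Rightarrow> bool" where
  "subfield_of K \<longleftrightarrow> subring_of K \<and> (\<forall>x\<in>K. inverse x \<in> K)"

text \<open>Polynomials over \<open>K\<close> stay polynomials over the ambient field, so they can
  be evaluated or factored outside \<open>K\<close> without a change of type.\<close>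

definition coeffs_in :: "'a::field set \<Rightarrow> 'a poly \<Rightarrow> bool" where
  "coeffs_in K p \<longleftrightarrow> (\<forall>i. coeff p i \<in> K)"

lemma subring_ofD:
  assumes "subring_of K"
  shows "1 \<in> K" "0 \<in> K" "x \<in> K \<Longrightarrow> - x \<in> K"
    "x \<in> K \<Longrightarrow> y \<in> K \<Longrightarrow> x + y \<in> K" "x \<in> K \<Longrightarrow> y \<in> K \<Longrightarrow> x - y \<in> K"
    "x \<in> K \<Longrightarrow> y \<in> K \<Longrightarrow> x * y \<in> K"
proof -
  show "1 \<in> K" "x \<in> K \<Longrightarrow> - x \<in> K" "x \<in> K \<Longrightarrow> y \<in> K \<Longrightarrow> x + y \<in> K"
    "x \<in> K \<Longrightarrow> y \<in> K \<Longrightarrow> x * y \<in> K"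
    using assms by (auto simp: subring_of_def)
  have "1 + (- 1) \<in> K"
    using assms unfolding subring_of_def by blast
  then show "0 \<in> K" by simp
  have "x + (- y) \<in> K" if "x \<in> K" "y \<in> K"
    using assms that unfolding subring_of_def by blast
  then show "x \<in> K \<Longrightarrow> y \<in> K \<Longrightarrow> x - y \<in> K" by simp
qed

lemma subring_of_sum: "subring_of K \<Longrightarrow> (\<And>i. i \<in> I \<Longrightarrow> g i \<in> K) \<Longrightarrow> sum g I \<in> K"
  by (induction I rule: infinite_finite_induct) (auto simp: subring_ofD)

lemma subring_of_power: "subring_of K \<Longrightarrow> x \<in> K \<Longrightarrow> x ^ k \<in> K"
  by (induction k) (auto simp: subring_ofD)

lemma subring_of_of_int: "subring_of K \<Longrightarrow> of_int k \<in> K"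
proof (induction k rule: int_induct[where k = 0])
  case base
  then show ?case by (simp add: subring_ofD)
next
  case (step1 i)
  then show ?case by (simp add: subring_ofD)
next
  case (step2 i)
  then show ?case by (simp add: subring_ofD)
qed

lemma subfield_ofD: "subfield_of K \<Longrightarrow> subring_of K" "subfield_of K \<Longrightarrow> x \<in> K \<Longrightarrow> inverse x \<in> K"
  by (auto simp: subfield_of_def)

lemma subfield_of_divide:
  assumes "subfield_of K" "x \<in> K" "y \<in> K"
  shows "x / y \<in> K"
  using assms by (simp add: divide_inverse subfield_ofD subring_ofD)

lemma subfield_of_powi:
  assumes "subfield_of K" "x \<in> K"
  shows "x powi k \<in> K"
  using assms by (auto simp: power_int_def subfield_ofD subring_of_power)

lemma Rats_subset_subfield_of:
  fixes K :: "'a::field_char_0 set"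
  assumes "subfield_of K"
  shows "\<rat> \<subseteq> K"
proof
  fix x :: 'a assume "x \<in> \<rat>"
  then obtain a b where "x = of_int a / of_int b"
    by (elim Rats_cases')
  then show "x \<in> K"
    using assms by (simp add: subfield_of_divide subfield_ofD subring_of_of_int)
qed

lemma subring_of_Ints: "subring_of \<int>"
  by (auto simp: subring_of_def)

lemma subfield_of_Rats: "subfield_of (\<rat> :: 'a::field_char_0 set)"
  by (auto simp: subring_of_def subfield_of_def)

section \<open>Polynomials with coefficients in a subring\<close>

lemma coeffs_in_arith:
  assumes "subring_of K" "coeffs_in K p" "coeffs_in K q"
  shows "coeffs_in K (p + q)" "coeffs_in K (p - q)" "coeffs_in K (- p)" "coeffs_in K (p * q)"
  using assms by (auto simp: coeffs_in_def coeff_mult intro!: subring_ofD subring_of_sum)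

lemma coeffs_in_0 [simp]: "subring_of K \<Longrightarrow> coeffs_in K 0"
  by (auto simp: coeffs_in_def subring_ofD)

lemma coeffs_in_pCons: "subring_of K \<Longrightarrow> coeffs_in K (pCons c p) \<longleftrightarrow> c \<in> K \<and> coeffs_in K p"
  by (auto simp: coeffs_in_def coeff_pCons split: nat.splits)

lemma coeffs_in_monom: "subring_of K \<Longrightarrow> c \<in> K \<Longrightarrow> coeffs_in K (monom c k)"
  by (auto simp: coeffs_in_def subring_ofD)

lemma coeffs_in_smult: "subring_of K \<Longrightarrow> c \<in> K \<Longrightarrow> coeffs_in K p \<Longrightarrow> coeffs_in K (smult c p)"
  by (auto simp: coeffs_in_def subring_ofD)

lemma coeffs_in_1 [simp]: "subring_of K \<Longrightarrow> coeffs_in K 1"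
  by (metis coeffs_in_monom monom_eq_1 subring_ofD(1))

lemma coeffs_in_power: "subring_of K \<Longrightarrow> coeffs_in K p \<Longrightarrow> coeffs_in K (p ^ k)"
  by (induction k) (auto intro: coeffs_in_arith)

lemma coeffs_in_pcompose:
  assumes "subring_of K" "coeffs_in K p" "coeffs_in K q"
  shows "coeffs_in K (pcompose p q)"
  using assms(2)
proof (induction p)
  case (pCons c p)
  then show ?case
    using assms by (auto simp: pcompose_pCons coeffs_in_pCons intro!: coeffs_in_arith)
qed (use assms in auto)

lemma coeffs_in_pderiv: "subring_of K \<Longrightarrow> coeffs_in K p \<Longrightarrow> coeffs_in K (pderiv p)"
  unfolding coeffs_in_def coeff_pderiv
  by (metis of_int_of_nat_eq subring_ofD(6) subring_of_of_int)

lemma coeffs_in_mono: "coeffs_in K p \<Longrightarrow> K \<subseteq> L \<Longrightarrow> coeffs_in L p"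
  by (auto simp: coeffs_in_def)

lemma poly_in_subring: "subring_of K \<Longrightarrow> coeffs_in K p \<Longrightarrow> x \<in> K \<Longrightarrow> poly p x \<in> K"
  by (induction p) (auto simp: coeffs_in_pCons subring_ofD)

text \<open>Cancelling the leading term against a monic divisor requires no inverses, so this covers
  division over \<open>\<int>\<close> as well as over fields.\<close>

lemma monic_division:
  assumes K: "subring_of K" and g: "coeffs_in K g" "lead_coeff g = 1" and "coeffs_in K p"
  shows "\<exists>q r. coeffs_in K q \<and> coeffs_in K r \<and> p = g * q + r \<and> (r = 0 \<or> degree r < degree g)"
  using assms(4)
proof (induction "degree p" arbitrary: p rule: less_induct)
  case less
  show ?case
  proof (cases "p = 0 \<or> degree p < degree g")
    case True
    then show ?thesis using less.prems K by (intro exI[of _ 0] exI[of _ p]) auto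
  next
    case False
    define m where "m = monom (lead_coeff p) (degree p - degree g)"
    define p' where "p' = p - g * m"
    have m: "coeffs_in K m"
      using less.prems K by (auto simp: m_def coeffs_in_def intro!: subring_ofD)
    have p': "coeffs_in K p'"
      using K m less.prems g by (auto simp: p'_def intro!: coeffs_in_arith)
    have dm: "degree (g * m) = degree p"
      using False g by (subst degree_mult_eq) (auto simp: m_def degree_monom_eq)
    have "lead_coeff (g * m) = lead_coeff p"
      using g False by (simp add: lead_coeff_mult m_def degree_monom_eq)
    then have c: "coeff p' (degree p) = 0"
      using dm by (simp add: p'_def)
    have le: "degree p' \<le> degree p"
      unfolding p'_def using degree_diff_le dm by (metis order_refl)
    have "\<exists>q r. coeffs_in K q \<and> coeffs_in K r \<and> p' = g * q + r \<and> (r = 0 \<or> degree r < degree g)"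
    proof (cases "p' = 0")
      case True
      then show ?thesis using K by (intro exI[of _ 0]) auto
    next
      case False
      then have "degree p' < degree p"
        using le c by (metis leading_coeff_0_iff le_neq_implies_less)
      then show ?thesis using less.hyps p' by blast
    qed
    then obtain q r where qr: "coeffs_in K q" "coeffs_in K r" "p' = g * q + r"
      "r = 0 \<or> degree r < degree g" by blast
    have "p = g * (q + m) + r"
      using qr(3) by (simp add: p'_def algebra_simps)
    then show ?thesis using qr m K by (metis coeffs_in_arith(1))
  qed
qed

lemma subfield_division:
  assumes K: "subfield_of K" and g: "coeffs_in K g" "g \<noteq> 0" and p: "coeffs_in K p"
  shows "\<exists>q r. coeffs_in K q \<and> coeffs_in K r \<and> p = g * q + r \<and> (r = 0 \<or> degree r < degree g)"
proof -
  let ?c = "inverse (lead_coeff g)"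
  note R = subfield_ofD(1)[OF K]
  have c: "?c \<in> K" using g K by (auto simp: coeffs_in_def subfield_ofD)
  have "coeffs_in K (smult ?c g)" "lead_coeff (smult ?c g) = 1"
    using g c R by (auto intro: coeffs_in_smult)
  from monic_division[OF R this p] obtain q r where qr: "coeffs_in K q" "coeffs_in K r"
    "p = smult ?c g * q + r" "r = 0 \<or> degree r < degree g" using g by auto
  show ?thesis
    using qr c R by (intro exI[of _ "smult ?c q"] exI[of _ r]) (auto intro: coeffs_in_smult)
qed

section \<open>Simple extensions as sets of polynomial values\<close>

definition simple_adjoin :: "'a::field set \<Rightarrow> 'a \<Rightarrow> 'a set" where
  "simple_adjoin K z = {poly p z | p. coeffs_in K p}"

lemma simple_adjoinI: "coeffs_in K p \<Longrightarrow> poly p z \<in> simple_adjoin K z"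
  by (auto simp: simple_adjoin_def)

lemma simple_adjoinE:
  assumes "x \<in> simple_adjoin K z"
  obtains p where "coeffs_in K p" "x = poly p z"
  using assms by (auto simp: simple_adjoin_def)

lemma subset_simple_adjoin: "subring_of K \<Longrightarrow> K \<subseteq> simple_adjoin K z"
proof
  fix x assume "subring_of K" "x \<in> K"
  then show "x \<in> simple_adjoin K z"
    using simple_adjoinI[of K "[:x:]" z] by (simp add: coeffs_in_pCons)
qed

lemma generator_in_simple_adjoin: "subring_of K \<Longrightarrow> z \<in> simple_adjoin K z"
  using simple_adjoinI[of K "[:0, 1:]" z] by (simp add: coeffs_in_pCons subring_ofD)

lemma subring_of_simple_adjoin:
  assumes "subring_of K"
  shows "subring_of (simple_adjoin K z)"
  unfolding subring_of_def
proof (intro conjI ballI)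
  show "1 \<in> simple_adjoin K z"
    using assms subset_simple_adjoin subring_ofD(1) by blast
next
  fix x assume "x \<in> simple_adjoin K z"
  then obtain p where "coeffs_in K p" "x = poly p z" by (elim simple_adjoinE)
  then show "- x \<in> simple_adjoin K z"
    using simple_adjoinI[of K "- p" z] coeffs_in_arith[OF assms] by simp
next
  fix x y assume "x \<in> simple_adjoin K z" "y \<in> simple_adjoin K z"
  then obtain p q where "coeffs_in K p" "x = poly p z" "coeffs_in K q" "y = poly q z"
    by (elim simple_adjoinE)
  then show "x + y \<in> simple_adjoin K z" "x * y \<in> simple_adjoin K z"
    using simple_adjoinI[of K "p + q" z] simple_adjoinI[of K "p * q" z] coeffs_in_arith[OF assms]
    by simp_all
qed

lemma ex_min_poly:
  assumes "coeffs_in K h" "h \<noteq> 0" "poly h z = 0"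
  obtains g where "coeffs_in K g" "g \<noteq> 0" "poly g z = 0" "degree g \<le> degree h"
    "\<And>p. coeffs_in K p \<Longrightarrow> poly p z = 0 \<Longrightarrow> degree p < degree g \<Longrightarrow> p = 0"
proof -
  let ?P = "\<lambda>g. coeffs_in K g \<and> g \<noteq> 0 \<and> poly g z = 0"
  obtain g where "?P g" "\<And>p. ?P p \<Longrightarrow> degree g \<le> degree p"
    using ex_has_least_nat[of ?P h degree] assms by blast
  then show thesis using that[of g] assms by force
qed

text \<open>Inverses come from the Euclidean algorithm against a polynomial \<open>g\<close> of
  least degree vanishing at \<open>z\<close>: if \<open>g = p * q + r\<close>, then
  \<open>r(z) = - p(z) q(z)\<close>, so inverting \<open>p(z)\<close> reduces to inverting
  \<open>r(z)\<close>, where \<open>r\<close> has smaller degree. Hence \<open>K[z]\<close> is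
  already the field \<open>K(z)\<close> for algebraic \<open>z\<close>.\<close>

lemma subfield_of_simple_adjoin:
  assumes K: "subfield_of K" and h: "coeffs_in K h" "h \<noteq> 0" "poly h z = 0"
  shows "subfield_of (simple_adjoin K z)"
proof -
  note R = subfield_ofD(1)[OF K]
  obtain g where g: "coeffs_in K g" "g \<noteq> 0" "poly g z = 0"
    and gmin: "\<And>p. coeffs_in K p \<Longrightarrow> poly p z = 0 \<Longrightarrow> degree p < degree g \<Longrightarrow> p = 0"
    using ex_min_poly[OF h] by metis
  have inv: "inverse (poly p z) \<in> simple_adjoin K z"
    if "coeffs_in K p" "poly p z \<noteq> 0" "degree p < degree g" for p
    using that
  proof (induction "degree p" arbitrary: p rule: less_induct)
    case less
    then have "p \<noteq> 0" by auto
    then obtain q r where qr: "coeffs_in K q" "coeffs_in K r" "g = p * q + r"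
      "r = 0 \<or> degree r < degree p"
      using subfield_division[OF K less.prems(1) _ g(1)] by blast
    have ev: "poly r z = - (poly p z * poly q z)"
      using g(3) qr(3) by (simp add: eq_neg_iff_add_eq_0 add.commute)
    show ?case
    proof (cases "r = 0")
      case True
      \<comment> \<open>Without a remainder \<open>q\<close> vanishes at \<open>z\<close>, so by
        minimality its degree is not below that of \<open>g\<close>; this leaves only a constant
        \<open>p\<close>.\<close>
      then have "poly q z = 0" "degree g = degree p + degree q" "q \<noteq> 0"
        using ev qr(3) less.prems g(2) by (auto simp: degree_mult_eq)
      then have "degree p = 0"
        using gmin[OF qr(1)] by (cases "degree p") auto
      then obtain c where c: "p = [:c:]" by (elim degree_eq_zeroE)
      then have "inverse c \<in> K"
        using less.prems(1) R by (simp add: coeffs_in_pCons subfield_ofD[OF K])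
      then show ?thesis using subset_simple_adjoin[OF R] c by auto
    next
      case False
      then have "degree r < degree p" using qr by auto
      moreover have nz: "poly r z \<noteq> 0"
        using gmin[OF qr(2)] False calculation less.prems(3) by auto
      ultimately have "inverse (poly r z) \<in> simple_adjoin K z"
        using less.hyps qr(2) less.prems(3) by simp
      then have "- (poly q z * inverse (poly r z)) \<in> simple_adjoin K z"
        using subring_of_simple_adjoin[OF R, of z] simple_adjoinI[OF qr(1), of z]
        by (simp add: subring_ofD)
      moreover have "- (poly q z * inverse (poly r z)) = inverse (poly p z)"
        using nz ev by (auto simp: field_simps)
      ultimately show ?thesis by simp
    qed
  qed
  show ?thesis
    unfolding subfield_of_def
  proof (intro conjI ballI subring_of_simple_adjoin R)
    fix x assume "x \<in> simple_adjoin K z"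
    then obtain p where p: "coeffs_in K p" "x = poly p z" by (elim simple_adjoinE)
    obtain q r where qr: "coeffs_in K q" "coeffs_in K r" "p = g * q + r" "r = 0 \<or> degree r < degree g"
      using subfield_division[OF K g(1,2) p(1)] by blast
    have x: "x = poly r z" using p qr g by simp
    show "inverse x \<in> simple_adjoin K z"
    proof (cases "x = 0")
      case True
      then show ?thesis
        using subring_ofD(2)[OF subring_of_simple_adjoin[OF R]] by simp
    next
      case False
      then show ?thesis using inv[OF qr(2)] qr(4) x by auto
    qed
  qed
qed

lemma simple_adjoin_subset: "subring_of L \<Longrightarrow> K \<subseteq> L \<Longrightarrow> z \<in> L \<Longrightarrow> simple_adjoin K z \<subseteq> L"
  by (auto elim!: simple_adjoinE intro!: poly_in_subring intro: coeffs_in_mono)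

section \<open>The field generated over \<open>\<rat>\<close> as a least subfield\<close>

lemma ring_of_type_algebra_simps:
  "monoid.mult ring_of_type_algebra = ((*) :: 'a::field \<Rightarrow> _)"
  "one ring_of_type_algebra = (1::'a)" "ring.zero ring_of_type_algebra = (0::'a)"
  "add ring_of_type_algebra = ((+) :: 'a \<Rightarrow> _)" "carrier ring_of_type_algebra = (UNIV :: 'a set)"
  by (auto simp: ring_of_type_algebra_def)

lemma a_inv_ring_of_type_algebra: "a_inv ring_of_type_algebra (x::'a::field) = - x"
proof -
  interpret ring "ring_of_type_algebra :: 'a ring" by (rule ring_from_type_algebra)
  show ?thesis
    using minus_equality[of "- x" x] by (simp add: ring_of_type_algebra_simps)
qed

lemma m_inv_ring_of_type_algebra:
  assumes "x \<noteq> (0::'a::field)"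
  shows "m_inv ring_of_type_algebra x = inverse x"
proof -
  interpret field "ring_of_type_algebra :: 'a ring" by (rule field_from_type_algebra)
  show ?thesis
    using comm_inv_char[of x "inverse x"] assms by (simp add: ring_of_type_algebra_simps)
qed

lemma subset_rat_adjoin: "S \<subseteq> rat_adjoin S"
  by (auto simp: rat_adjoin_def intro: generate_field.incl)

lemma subfield_of_rat_adjoin: "subfield_of (rat_adjoin S)"
proof -
  let ?R = "ring_of_type_algebra :: complex ring"
  have inv: "inverse x \<in> rat_adjoin S" if "x \<in> rat_adjoin S" for x
  proof (cases "x = 0")
    case False
    then show ?thesis
      using generate_field.m_inv[of x ?R] that
      by (simp add: rat_adjoin_def ring_of_type_algebra_simps m_inv_ring_of_type_algebra)
  qed (use that in simp)
  have "- x \<in> rat_adjoin S" if "x \<in> rat_adjoin S" for x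
    using generate_field.a_inv[of x ?R] that
    by (simp add: rat_adjoin_def a_inv_ring_of_type_algebra)
  moreover have "x + y \<in> rat_adjoin S" "x * y \<in> rat_adjoin S"
    if "x \<in> rat_adjoin S" "y \<in> rat_adjoin S" for x y
    using generate_field.eng_add[of x ?R] generate_field.eng_mult[of x ?R] that
    by (simp_all add: rat_adjoin_def ring_of_type_algebra_simps)
  moreover have "1 \<in> rat_adjoin S"
    using generate_field.one[of ?R] by (simp add: rat_adjoin_def ring_of_type_algebra_simps)
  ultimately show ?thesis using inv by (auto simp: subfield_of_def subring_of_def)
qed

text \<open>Together with \<open>subset_rat_adjoin\<close> and \<open>subfield_of_rat_adjoin\<close>
  this characterises \<open>rat_adjoin S\<close> as the least subfield containing \<open>S\<close>;
  all later arguments go through this characterisation.\<close>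

lemma rat_adjoin_least:
  assumes K: "subfield_of K" and S: "S \<subseteq> K"
  shows "rat_adjoin S \<subseteq> K"
proof
  note R = subfield_ofD(1)[OF K]
  fix x assume "x \<in> rat_adjoin S"
  then have "x \<in> generate_field ring_of_type_algebra (\<rat> \<union> S)" by (simp add: rat_adjoin_def)
  then show "x \<in> K"
  proof (induction rule: generate_field.induct)
    case (incl h)
    then show ?case using S Rats_subset_subfield_of[OF K] by auto
  qed (use R K in \<open>auto simp: ring_of_type_algebra_simps a_inv_ring_of_type_algebra
      m_inv_ring_of_type_algebra subring_ofD subfield_ofD\<close>)
qed

lemma rat_adjoin_mono: "S \<subseteq> T \<Longrightarrow> rat_adjoin S \<subseteq> rat_adjoin T"
  by (meson order_trans rat_adjoin_least subfield_of_rat_adjoin subset_rat_adjoin)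

subsection \<open>Irreducibility of cyclotomic polynomials\<close>

lemma map_poly_of_int_mult:
  "map_poly of_int (p * q) = map_poly of_int p * (map_poly of_int q :: 'a::{comm_ring_1, ring_char_0} poly)"
  by (rule poly_eqI) (simp add: coeff_map_poly coeff_mult)

lemma map_poly_of_int_diff:
  "map_poly of_int (p - q) = map_poly of_int p - (map_poly of_int q :: 'a::{comm_ring_1, ring_char_0} poly)"
  by (rule poly_eqI) (simp add: coeff_map_poly)

lemma map_poly_of_int_smult:
  "map_poly of_int (smult c p) = smult (of_int c) (map_poly of_int p :: 'a::{comm_ring_1, ring_char_0} poly)"
  by (rule poly_eqI) (simp add: coeff_map_poly)

lemma coeffs_in_Ints_obtain:
  fixes p :: "'a::field_char_0 poly"
  assumes "coeffs_in \<int> p"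
  obtains q :: "int poly" where "p = map_poly of_int q" "degree q = degree p" "q = 0 \<longleftrightarrow> p = 0"
proof -
  have "\<exists>q :: int poly. p = map_poly of_int q"
    using assms
  proof (induction p)
    case (pCons c p)
    then obtain q :: "int poly" and k where "p = map_poly of_int q" "c = of_int k"
      by (auto simp: coeffs_in_pCons[OF subring_of_Ints] elim: Ints_cases)
    then show ?case by (intro exI[of _ "pCons k q"]) (simp add: map_poly_pCons)
  qed (auto intro: exI[of _ 0])
  then obtain q :: "int poly" where "p = map_poly of_int q" by blast
  then show thesis by (intro that[of q]) (auto simp: degree_map_poly map_poly_eq_0_iff)
qed

lemma Rats_poly_clear_denominators:
  fixes p :: "'a::field_char_0 poly"
  assumes "coeffs_in \<rat> p"
  shows "\<exists>N::int. N \<noteq> 0 \<and> coeffs_in \<int> (smult (of_int N) p)"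
  using assms
proof (induction p)
  case 0
  show ?case by (intro exI[of _ 1]) (simp add: subring_of_Ints)
next
  case (pCons c p)
  then obtain N :: int where N: "N \<noteq> 0" "coeffs_in \<int> (smult (of_int N) p)"
    by (auto simp: coeffs_in_pCons[OF subfield_ofD(1)[OF subfield_of_Rats]])
  have "c \<in> \<rat>"
    using pCons.prems by (simp add: coeffs_in_pCons[OF subfield_ofD(1)[OF subfield_of_Rats]])
  then obtain a b where ab: "b > 0" "c = of_int a / of_int b" by (elim Rats_cases')
  have "coeffs_in \<int> (smult (of_int b) (smult (of_int N) p))"
    using N by (intro coeffs_in_smult[of _ "of_int b" "smult (of_int N) p"]) (auto simp: subring_of_Ints)
  then have "coeffs_in \<int> (smult (of_int (b * N)) (pCons c p))"
    using ab by (auto simp: coeffs_in_pCons[OF subring_of_Ints])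
  then show ?case using ab N by (intro exI[of _ "b * N"]) auto
qed

text \<open>Gauss's lemma: an integer polynomial of least degree vanishing at \<open>z\<close>, made primitive, divides
  \<open>x ^ n - 1\<close> over the integers and hence has leading coefficient \<open>\<plusminus> 1\<close>.\<close>

lemma root_of_unity_int_min_poly:
  fixes z :: complex
  assumes n: "n > 0" and z: "z ^ n = 1"
  obtains G where "coeffs_in \<int> G" "lead_coeff G = 1" "poly G z = 0"
    "\<And>p. coeffs_in \<rat> p \<Longrightarrow> poly p z = 0 \<Longrightarrow> G dvd p"
proof -
  let ?c = "map_poly of_int :: int poly \<Rightarrow> complex poly"
  let ?P = "\<lambda>f::int poly. f \<noteq> 0 \<and> poly (?c f) z = 0"
  define U where "U = (monom 1 n - 1 :: int poly)"
  have Un: "coeff U n = 1" using n by (simp add: U_def)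
  have degU: "degree U = n"
    unfolding U_def diff_conv_add_uminus using n
    by (subst degree_add_eq_left) (auto simp: degree_monom_eq)
  have "U \<noteq> 0" using Un by auto
  then have "?P U"
    using z by (intro conjI) (auto simp: U_def map_poly_of_int_diff map_poly_monom poly_monom)
  then obtain f0 where f0: "?P f0" and f0min: "\<And>g. ?P g \<Longrightarrow> degree f0 \<le> degree g"
    using ex_has_least_nat[of ?P U degree] by blast
  define f where "f = primitive_part f0"
  have f: "f \<noteq> 0" "content f = 1" "degree f = degree f0"
    using f0 by (auto simp: f_def degree_primitive_part)
  have "poly (?c (smult (content f0) f)) z = 0"
    using f0 by (simp add: f_def content_times_primitive_part)
  then have fz: "poly (?c f) z = 0"
    using f0 by (simp add: map_poly_of_int_smult)
  \<comment> \<open>Pseudo-division stays within integer polynomials at the price of the factor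
    \<open>a\<close>. Its remainder vanishes at \<open>z\<close>, so minimality of the degree of
    \<open>f\<close> forces it to be zero.\<close>
  obtain a q where aq: "a \<noteq> 0" "smult a U = f * q + pseudo_mod U f"
    using pseudo_mod(1)[OF f(1)] by blast
  have "poly (?c (pseudo_mod U f)) z = poly (?c (smult a U - f * q)) z"
    using aq by simp
  also have "\<dots> = 0"
    using z fz by (simp add: U_def map_poly_of_int_diff map_poly_of_int_mult map_poly_of_int_smult
        map_poly_monom poly_monom)
  finally have "pseudo_mod U f = 0"
    using pseudo_mod(2)[OF f(1), of U] f0min[of "pseudo_mod U f"] f(3) by force
  then have eq: "smult a U = f * q" using aq by simp
  have "content U dvd 1" using Un by (metis content_dvd_coeff)
  then have cU: "content U = 1" by (simp only: is_unit_content_iff)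
  \<comment> \<open>By multiplicativity of contents \<open>q\<close> absorbs all of \<open>a\<close>
    up to sign, so \<open>f * primitive_part q\<close> is \<open>U\<close> or \<open>- U\<close> and
    the leading coefficient of \<open>f\<close> is a unit.\<close>
  have "content q = \<bar>a\<bar>"
    using arg_cong[OF eq, of content] f cU by (simp add: content_mult)
  then have eq': "smult a U = smult \<bar>a\<bar> (f * primitive_part q)"
    using eq by (metis content_times_primitive_part mult_smult_right)
  then have "coeff (smult a U) n = \<bar>a\<bar> * coeff (f * primitive_part q) n" by simp
  then have "a = \<bar>a\<bar> * coeff (f * primitive_part q) n" using Un by simp
  moreover have "degree (f * primitive_part q) = n"
    using arg_cong[OF eq', of degree] aq(1) degU by simp
  ultimately have "a = \<bar>a\<bar> * lead_coeff f * lead_coeff (primitive_part q)"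
    by (metis lead_coeff_mult mult.assoc)
  then have "\<bar>a\<bar> = \<bar>a\<bar> * (\<bar>lead_coeff f\<bar> * \<bar>lead_coeff (primitive_part q)\<bar>)"
    by (metis abs_mult abs_abs mult.assoc)
  then have "\<bar>lead_coeff f\<bar> * \<bar>lead_coeff (primitive_part q)\<bar> = 1"
    using aq(1) by simp
  then have lf: "\<bar>lead_coeff f\<bar> = 1" by (metis abs_ge_zero pos_zmult_eq_1_iff mult_zero_left zero_neq_one order_le_less)
  define G where "G = ?c (smult (lead_coeff f) f)"
  have lf2: "lead_coeff f * lead_coeff f = 1" using lf by (metis abs_mult_self_eq mult_1)
  have lf0: "lead_coeff f \<noteq> 0" using lf by auto
  have degG: "degree G = degree f"
    unfolding G_def using lf0 by (subst degree_map_poly) (auto simp: degree_smult_eq)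
  have G1: "coeffs_in \<int> G" by (auto simp: G_def coeffs_in_def coeff_map_poly)
  have G2: "lead_coeff G = 1"
    unfolding degG using lf2 by (simp add: G_def coeff_map_poly flip: of_int_mult)
  have G3: "poly G z = 0" using fz by (simp add: G_def map_poly_of_int_smult)
  have G4: "G dvd p" if p: "coeffs_in \<rat> p" "poly p z = 0" for p
  proof -
    have "coeffs_in \<rat> G" using G1 coeffs_in_mono Ints_subset_Rats by blast
    from monic_division[OF subfield_ofD(1)[OF subfield_of_Rats] this G2 p(1)]
    obtain q r where qr: "coeffs_in \<rat> r" "p = G * q + r" "r = 0 \<or> degree r < degree G" by blast
    \<comment> \<open>\<open>f\<close> has least degree among integer polynomials only, so the
      rational remainder is first cleared of denominators.\<close>
    obtain N :: int where N: "N \<noteq> 0" "coeffs_in \<int> (smult (of_int N) r)"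
      using Rats_poly_clear_denominators[OF qr(1)] by blast
    obtain r' :: "int poly" where r': "smult (of_int N) r = ?c r'"
      "degree r' = degree (smult (of_int N) r)" "r' = 0 \<longleftrightarrow> smult (of_int N) r = 0"
      using coeffs_in_Ints_obtain[OF N(2)] by metis
    have "poly (?c r') z = 0" using qr(2) p(2) G3 by (simp flip: r'(1))
    then have "r' = 0 \<or> degree f \<le> degree r'" using f0min f(3) by auto
    moreover have "degree r' = degree r" "r' = 0 \<longleftrightarrow> r = 0"
      unfolding r'(2,3) using N(1) by simp_all
    ultimately have "r = 0" using qr(3) degG by auto
    then show ?thesis using qr by simp
  qed
  show thesis using that G1 G2 G3 G4 by blast
qed

text \<open>The prime \<open>q\<close> divides every inner binomial coefficient, so the mixed terms
  share the factor \<open>q\<close>, and \<open>E\<close> collects the quotients.\<close>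

lemma prime_power_add_coeffs_in:
  fixes A B :: "'a::field_char_0 poly"
  assumes "prime q" "coeffs_in \<int> A" "coeffs_in \<int> B"
  shows "\<exists>E. coeffs_in \<int> E \<and> (A + B) ^ q = A ^ q + B ^ q + smult (of_nat q) E"
proof -
  have q: "q > 0" using assms(1) prime_gt_0_nat by blast
  define E where "E = (\<Sum>k\<in>{0<..<q}. of_nat ((q choose k) div q) * (A ^ k * B ^ (q - k)))"
  have "{..q} = insert 0 (insert q {0<..<q})" using q by auto
  then have "(A + B) ^ q = A ^ q + B ^ q + (\<Sum>k\<in>{0<..<q}. of_nat (q choose k) * A ^ k * B ^ (q - k))"
    unfolding binomial_ring using q by (simp add: algebra_simps)
  also have "(\<Sum>k\<in>{0<..<q}. of_nat (q choose k) * A ^ k * B ^ (q - k)) = of_nat q * E"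
    unfolding E_def sum_distrib_left
  proof (rule sum.cong[OF refl])
    fix k assume "k \<in> {0<..<q}"
    then have "q dvd (q choose k)" using assms(1) dvd_choose_prime by auto
    then have "of_nat (q choose k) = (of_nat q * of_nat ((q choose k) div q) :: 'a poly)"
      by (simp flip: of_nat_mult)
    then show "of_nat (q choose k) * A ^ k * B ^ (q - k) =
        of_nat q * (of_nat ((q choose k) div q) * (A ^ k * B ^ (q - k)))"
      by (simp add: mult.assoc)
  qed
  finally have "(A + B) ^ q = A ^ q + B ^ q + smult (of_nat q) E" by (simp add: of_nat_poly)
  moreover have "coeffs_in \<int> (of_nat k * (A ^ i * B ^ j))" for i j k
    unfolding of_nat_poly
    using assms by (intro coeffs_in_arith coeffs_in_power subring_of_Ints)
      (auto simp: coeffs_in_pCons subring_of_Ints)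
  then have "coeffs_in \<int> E"
    unfolding E_def coeffs_in_def coeff_sum by (intro allI Ints_sum) auto
  ultimately show ?thesis by blast
qed

text \<open>Multiples of \<open>q\<close> are immediate; any other \<open>c\<close> is replaced by
  its residue \<open>b\<close>, a natural number to which Fermat's little theorem applies.\<close>

lemma fermat_int: "prime q \<Longrightarrow> int q dvd c ^ q - c"
proof (cases "int q dvd c")
  case True
  assume "prime q"
  then have "q \<noteq> 0" by auto
  then show ?thesis using True by (intro dvd_diff) (auto intro: dvd_power_le dvd_trans[OF True])
next
  case False
  assume q: "prime q"
  define b where "b = nat (c mod int q)"
  have q0: "q > 0" using q prime_gt_0_nat by blast
  have b: "int b = c mod int q" using q0 by (simp add: b_def)
  then have "\<not> int q dvd int b" using False by (simp add: dvd_eq_mod_eq_0)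
  then have "\<not> q dvd b" by simp
  then have "[b ^ (q - 1) = 1] (mod q)" using fermat_theorem q by blast
  then have "[b ^ (q - 1) * b = 1 * b] (mod q)" by (rule cong_scalar_right)
  then have "[b ^ q = b] (mod q)" using q0 by (metis mult_1 power_minus_mult)
  then have "[int b ^ q = int b] (mod int q)" by (metis cong_int_iff of_nat_power)
  moreover have "[c = int b] (mod int q)" by (simp add: b cong_def)
  ultimately have "[c ^ q = c] (mod int q)"
    by (meson cong_pow cong_sym cong_trans)
  then show ?thesis by (simp add: cong_iff_dvd_diff)
qed

text \<open>Modulo \<open>q\<close>, taking \<open>q\<close>-th powers is additive and fixes integer
  constants, so it turns \<open>p(x)\<close> into \<open>p(x ^ q)\<close>. Induction on the
  coefficients makes this an identity with an explicit error \<open>q * w\<close>.\<close>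

lemma frobenius_coeffs_in:
  fixes p :: "'a::field_char_0 poly"
  assumes q: "prime q" and "coeffs_in \<int> p"
  shows "\<exists>w. coeffs_in \<int> w \<and> p ^ q = pcompose p (monom 1 q) + smult (of_nat q) w"
  using assms(2)
proof (induction p)
  case 0
  then show ?case using q by (intro exI[of _ 0]) (auto simp: power_0_left subring_of_Ints)
next
  case (pCons c p)
  have R: "subring_of (\<int> :: 'a set)" by (rule subring_of_Ints)
  have cp: "c \<in> \<int>" "coeffs_in \<int> p" using pCons.prems by (auto simp: coeffs_in_pCons[OF R])
  then obtain w where w: "coeffs_in \<int> w" "p ^ q = pcompose p (monom 1 q) + smult (of_nat q) w"
    using pCons.IH by blast
  obtain k where k: "c = of_int k" using cp(1) by (elim Ints_cases)
  obtain l where l: "k ^ q - k = int q * l" using fermat_int[OF q, of k] by (elim dvdE)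
  have "c ^ q - c = of_int (k ^ q - k)" by (simp add: k)
  then have cq: "c ^ q = c + of_nat q * of_int l" using l by (simp add: algebra_simps)
  have "coeffs_in \<int> [:c:]" "coeffs_in \<int> (monom 1 1 * p)"
    using cp R by (auto simp: coeffs_in_pCons intro!: coeffs_in_arith coeffs_in_monom)
  then obtain E where E: "coeffs_in \<int> E"
    "([:c:] + monom 1 1 * p) ^ q = [:c:] ^ q + (monom 1 1 * p) ^ q + smult (of_nat q) E"
    using prime_power_add_coeffs_in[OF q] by blast
  have "pCons c p = [:c:] + monom 1 1 * p" by (simp add: monom_altdef)
  then have "pCons c p ^ q = [:c ^ q:] + monom 1 q * p ^ q + smult (of_nat q) E"
    using E(2) by (simp add: poly_const_pow power_mult_distrib monom_power)
  also have "\<dots> = pcompose (pCons c p) (monom 1 q) + smult (of_nat q) ([:of_int l:] + monom 1 q * w + E)"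
    unfolding w(2) cq by (simp add: pcompose_pCons algebra_simps smult_add_right)
  finally have "pCons c p ^ q = pcompose (pCons c p) (monom 1 q) +
    smult (of_nat q) ([:of_int l:] + monom 1 q * w + E)" .
  moreover have "coeffs_in \<int> ([:of_int l:] + monom 1 q * w + E)"
    using w(1) E(1) R by (auto intro!: coeffs_in_arith coeffs_in_monom simp: coeffs_in_pCons)
  ultimately show ?case by blast
qed

text \<open>The mod \<open>q\<close> argument for the irreducibility of cyclotomic polynomials, done in \<open>\<int>[z]\<close>: if \<open>G\<close> did not
  vanish at \<open>z ^ q\<close>, the derivative of \<open>x ^ n - 1 = G h\<close> at \<open>z ^ q\<close> would exhibit \<open>n\<close> as a multiple
  of \<open>q\<close> in \<open>\<int>[z]\<close>, because \<open>G(z ^ q) \<equiv> G(z) ^ q = 0\<close>.\<close>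

lemma rat_poly_root_prime_power:
  fixes z :: complex
  assumes n: "n > 0" and z: "z ^ n = 1" and q: "prime q" "\<not> q dvd n"
    and p: "coeffs_in \<rat> p" "poly p z = 0"
  shows "poly p (z ^ q) = 0"
proof -
  have R: "subring_of (\<int> :: complex set)" by (rule subring_of_Ints)
  obtain G where G: "coeffs_in \<int> G" "lead_coeff G = 1" "poly G z = 0"
    and Gmin: "\<And>p. coeffs_in \<rat> p \<Longrightarrow> poly p z = 0 \<Longrightarrow> G dvd p"
    using root_of_unity_int_min_poly[OF n z] by blast
  have Rats: "coeffs_in \<rat> p" if "coeffs_in \<int> p" for p :: "complex poly"
    using that coeffs_in_mono Ints_subset_Rats by blast
  have degG: "degree G > 0"
  proof (rule ccontr)
    assume "\<not> degree G > 0"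
    then obtain c where "G = [:c:]" by (auto elim: degree_eq_zeroE)
    then show False using G by auto
  qed
  define y where "y = z ^ q"
  have y: "y ^ n = 1" using z by (metis y_def power_mult mult.commute power_one)
  have "poly G y = 0"
  proof (rule ccontr)
    assume Gy: "poly G y \<noteq> 0"
    define U where "U = (monom 1 n - 1 :: complex poly)"
    have U: "coeffs_in \<int> U"
      using R by (auto simp: U_def intro!: coeffs_in_arith coeffs_in_monom)
    obtain h r where h: "coeffs_in \<int> h" "coeffs_in \<int> r" "U = G * h + r" "r = 0 \<or> degree r < degree G"
      using monic_division[OF R G(1,2) U] by blast
    have "poly r z = 0" using arg_cong[OF h(3), of "\<lambda>p. poly p z"] z G(3) by (simp add: U_def poly_monom)
    then have "r = 0" using Gmin[OF Rats[OF h(2)]] h(4) by (metis dvd_imp_degree_le not_le)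
    then have Uh: "U = G * h" using h by simp
    have "poly U y = 0" using y by (simp add: U_def poly_monom)
    then have hy: "poly h y = 0" using Uh Gy by simp
    have "pderiv U = monom (of_nat n) (n - 1)"
      by (simp add: U_def pderiv_diff pderiv_monom)
    then have "of_nat n * y ^ (n - 1) = poly G y * poly (pderiv h) y"
      using Uh hy by (simp add: pderiv_mult poly_monom flip: poly_mult)
        (metis add.right_neutral hy mult_zero_left poly_add poly_monom poly_mult)
    moreover have "y ^ (n - 1) * y = 1"
      using y n power_minus_mult[of n y] by metis
    ultimately have ny: "of_nat n = poly G y * poly (pderiv h) y * y"
      by (metis mult.assoc mult.right_neutral)
    obtain w where w: "coeffs_in \<int> w" "G ^ q = pcompose G (monom 1 q) + smult (of_nat q) w"
      using frobenius_coeffs_in[OF q(1) G(1)] by blast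
    have "poly (G ^ q) z = poly G y + of_nat q * poly w z"
      by (simp add: w(2) poly_pcompose poly_monom y_def)
    moreover have "poly (G ^ q) z = 0" using G(3) q(1) by (auto simp: poly_power power_0_left)
    ultimately have Gw: "poly G y = - (of_nat q * poly w z)" by (simp add: eq_neg_iff_add_eq_0)
    \<comment> \<open>The cofactor of \<open>q\<close> in
      \<open>of_nat n = poly G y * poly (pderiv h) y * y\<close>, written as an integer polynomial
      in \<open>z\<close>; composition with \<open>monom 1 q\<close> expresses values at
      \<open>y = z ^ q\<close>.\<close>
    define u where "u = - (w * pcompose (pderiv h) (monom 1 q) * monom 1 q)"
    have u: "coeffs_in \<int> u"
      unfolding u_def using w(1) h(1) R
      by (intro coeffs_in_arith coeffs_in_pcompose coeffs_in_monom coeffs_in_pderiv) auto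
    have nu: "of_nat n = of_nat q * poly u z"
      using ny unfolding Gw by (simp add: u_def poly_pcompose poly_monom y_def)
    \<comment> \<open>Reducing \<open>u\<close> modulo \<open>G\<close> leaves
      \<open>n - q * t(x)\<close>, which vanishes at \<open>z\<close> and has degree below that of
      \<open>G\<close>. It is therefore zero, and its constant coefficient shows that
      \<open>q\<close> divides \<open>n\<close>.\<close>
    obtain s t where st: "coeffs_in \<int> t" "u = G * s + t" "t = 0 \<or> degree t < degree G"
      using monic_division[OF R G(1,2) u] by blast
    define v where "v = [:of_nat n:] - smult (of_nat q) t"
    have "coeffs_in \<int> v"
      unfolding v_def using st R by (intro coeffs_in_arith coeffs_in_smult) (auto simp: coeffs_in_pCons)
    moreover have "poly v z = 0" using nu st G(3) by (simp add: v_def)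
    ultimately have "G dvd v" using Gmin Rats by blast
    moreover have "degree v < degree G"
    proof -
      have "degree (smult (of_nat q) t) < degree G"
        using st(3) degG by (metis degree_0 degree_smult_le order_le_less_trans)
      then show ?thesis unfolding v_def using degG by (intro degree_diff_less) auto
    qed
    ultimately have "v = 0" by (metis dvd_imp_degree_le not_le)
    then have "coeff v 0 = 0" by simp
    then have e: "of_nat n = of_nat q * coeff t 0" by (simp add: v_def)
    obtain m where m: "coeff t 0 = of_int m" using st(1) by (auto simp: coeffs_in_def elim: Ints_cases)
    have "(of_int (int n) :: complex) = of_int (int q * m)" using e m by simp
    then have "int n = int q * m" by (simp only: of_int_eq_iff)
    then show False using q(2) by (metis dvd_triv_left int_dvd_int_iff)
  qed
  then show ?thesis using Gmin[OF p] by (auto simp: y_def elim!: dvdE)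
qed

text \<open>The prime factors of \<open>k\<close> are used one at a time: for such a factor
  \<open>q\<close>, \<open>z ^ q\<close> is again an \<open>n\<close>-th root of unity and a zero of
  \<open>p\<close>, so the induction continues from it with exponent \<open>k / q\<close>.\<close>

lemma rat_poly_root_coprime_power:
  fixes z :: complex
  assumes n: "n > 0" and "z ^ n = 1" "k > 0" "coprime k n"
    and p: "coeffs_in \<rat> p" "poly p z = 0"
  shows "poly p (z ^ k) = 0"
  using assms(2-)
proof (induction k arbitrary: z rule: less_induct)
  case (less k)
  show ?case
  proof (cases "k = 1")
    case True
    then show ?thesis using less.prems by simp
  next
    case False
    then obtain q where q: "prime q" "q dvd k" using prime_factor_nat by blast
    then obtain l where l: "k = q * l" by (elim dvdE)
    have "\<not> q dvd n"
      using q less.prems(3) by (meson coprime_common_divisor_nat not_prime_1 coprime_common_divisor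
          not_prime_unit)
    then have "poly p (z ^ q) = 0"
      using rat_poly_root_prime_power n less.prems q by blast
    moreover have "(z ^ q) ^ n = 1" using less.prems(1) by (metis power_mult mult.commute power_one)
    moreover have "l > 0" "l < k" "coprime l n"
      using l less.prems(2,3) prime_gt_1_nat[OF q(1)] by (auto simp: coprime_commute)
    ultimately have "poly p ((z ^ q) ^ l) = 0" using less.IH less.prems(4) by blast
    then show ?thesis by (simp add: l power_mult)
  qed
qed

lemma coprime_iff_no_common_prime:
  fixes x y :: nat
  shows "coprime x y \<longleftrightarrow> (\<forall>p. prime p \<and> p dvd y \<longrightarrow> \<not> p dvd x)"
proof
  show "\<forall>p. prime p \<and> p dvd y \<longrightarrow> \<not> p dvd x" if "coprime x y"
    using that coprime_common_divisor not_prime_unit by blast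
  show "coprime x y" if *: "\<forall>p. prime p \<and> p dvd y \<longrightarrow> \<not> p dvd x"
  proof (rule ccontr)
    assume "\<not> coprime x y"
    then obtain p where "prime p" "p dvd gcd x y"
      using prime_factor_nat[of "gcd x y"] by (auto simp: coprime_iff_gcd_eq_1)
    then have "p dvd x" "p dvd y" by auto
    then show False using * \<open>prime p\<close> by blast
  qed
qed

section \<open>Primitive roots of unity and their powers\<close>

lemma primitive_root_of_unityD:
  assumes "primitive_root_of_unity n z"
  shows "n > 0" "z ^ n = 1" "z \<noteq> 0"
  using assms by (auto simp: primitive_root_of_unity_def power_0_left)

lemma primitive_root_powi_eq_1_iff:
  assumes "primitive_root_of_unity n z"
  shows "z powi k = 1 \<longleftrightarrow> int n dvd k"
proof -
  note z = primitive_root_of_unityD[OF assms]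
  have "z powi (int n * i + j) = z powi j" for i j
    using z by (simp add: power_int_add power_int_mult)
  from this[of "k div int n" "k mod int n"] have "z powi k = z powi (k mod int n)" by simp
  also have "\<dots> = z ^ nat (k mod int n)"
    using z(1) by (simp add: power_int_nonneg_exp)
  finally have eq: "z powi k = z ^ nat (k mod int n)" .
  have "nat (k mod int n) < n" using z(1) by (simp add: nat_less_iff)
  then have "z ^ nat (k mod int n) = 1 \<longleftrightarrow> nat (k mod int n) = 0"
    using assms by (metis primitive_root_of_unity_def gr0I power_0)
  also have "\<dots> \<longleftrightarrow> k mod int n = 0"
    using z(1) pos_mod_sign[of "int n" k] by linarith
  finally show ?thesis using eq by (simp add: dvd_eq_mod_eq_0)
qed

lemma primitive_root_powi_eq_iff:
  assumes "primitive_root_of_unity n z"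
  shows "z powi k = z powi l \<longleftrightarrow> int n dvd k - l"
  using primitive_root_powi_eq_1_iff[OF assms, of "k - l"] primitive_root_of_unityD[OF assms]
  by (auto simp: power_int_diff)

text \<open>The \<open>n\<close> powers are distinct and there are exactly \<open>n\<close> roots of
  unity, so the inclusion of finite sets is an equality.\<close>

lemma roots_of_unity_eq_powers:
  assumes "primitive_root_of_unity n z"
  shows "{w. w ^ n = 1} = (\<lambda>k. z ^ k) ` {..<n}"
proof (rule sym, rule card_subset_eq)
  note z = primitive_root_of_unityD[OF assms]
  show "finite {w::complex. w ^ n = 1}" using z(1) by (intro finite_roots_unity) auto
  show "(\<lambda>k. z ^ k) ` {..<n} \<subseteq> {w. w ^ n = 1}"
    using z(2) by (auto simp flip: power_mult) (metis mult.commute power_mult power_one)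
  have "inj_on (\<lambda>k. z ^ k) {..<n}"
  proof (rule inj_onI)
    fix i j assume ij: "i \<in> {..<n}" "j \<in> {..<n}" "z ^ i = z ^ j"
    then have "z powi (int i) = z powi (int j)" by simp
    then have "int n dvd int i - int j"
      using primitive_root_powi_eq_iff[OF assms] by blast
    then show "i = j" using ij(1,2) dvd_imp_le_int[of "int i - int j" "int n"] by fastforce
  qed
  then show "card ((\<lambda>k. z ^ k) ` {..<n}) = card {w::complex. w ^ n = 1}"
    using z(1) by (simp add: card_image card_roots_unity_eq)
qed

text \<open>The exponent \<open>k = 1 + j n / p\<close>, with \<open>j\<close> one of \<open>1\<close>, \<open>2\<close>, is coprime to \<open>n\<close>; the conjugation \<open>z \<mapsto> z ^ k\<close>
  fixes \<open>z ^ p\<close> and moves \<open>z\<close>.\<close>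

lemma primitive_root_notin_prime_power_field:
  assumes z: "primitive_root_of_unity n z" and n: "odd n" and p: "prime p" "p dvd n"
  shows "z \<notin> simple_adjoin \<rat> (z ^ p)"
proof
  assume "z \<in> simple_adjoin \<rat> (z ^ p)"
  then obtain h where h: "coeffs_in \<rat> h" "z = poly h (z ^ p)" by (elim simple_adjoinE)
  note R = subfield_ofD(1)[OF subfield_of_Rats[where 'a = complex]]
  obtain m where m: "n = p * m" using p(2) by (elim dvdE)
  \<comment> \<open>Oddness of \<open>n\<close> enters here: it leaves room for \<open>j = 2\<close>
    below \<open>p\<close>.\<close>
  have p3: "p > 2" using p n m prime_ge_2_nat[OF p(1)] by (cases "p = 2") auto
  have m0: "m > 0" using primitive_root_of_unityD(1)[OF z] m by (cases m) auto
  have "\<exists>j. 0 < j \<and> j < p \<and> coprime (1 + m * j) n"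
  proof -
    \<comment> \<open>A prime divisor of \<open>n = p * m\<close> other than \<open>p\<close>
      divides \<open>m\<close>, so it cannot divide \<open>1 + m * j\<close>; only \<open>p\<close>
      can obstruct coprimality.\<close>
    have other: "r = p" if "prime r" "r dvd 1 + m * j" "r dvd n" for r j
    proof (rule ccontr)
      assume "r \<noteq> p"
      then have "r dvd m"
        using that(1,3) p(1) m by (metis prime_dvd_mult_iff primes_dvd_imp_eq)
      then have "r dvd m * j" by simp
      then have "r dvd 1" using that(2) by (metis dvd_add_left_iff)
      then show False using that(1) by simp
    qed
    \<comment> \<open>The two values differ by \<open>m\<close>, so \<open>p\<close> would divide
      \<open>m\<close> and then \<open>1\<close>.\<close>
    have "\<not> (p dvd 1 + m * 1 \<and> p dvd 1 + m * 2)"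
    proof
      assume *: "p dvd 1 + m * 1 \<and> p dvd 1 + m * 2"
      then have "p dvd (1 + m * 2) - (1 + m * 1)" using dvd_diff_nat by blast
      then have "p dvd m" by simp
      then have "p dvd 1" using * by (metis dvd_add_left_iff mult.right_neutral)
      then show False using p(1) by simp
    qed
    then obtain j where j: "j = 1 \<or> j = 2" "\<not> p dvd 1 + m * j" by blast
    have "coprime (1 + m * j) n"
      unfolding coprime_iff_no_common_prime using other j(2) by blast
    moreover have "0 < j" "j < p" using j(1) p3 by auto
    ultimately show ?thesis by blast
  qed
  then obtain j where j: "0 < j" "j < p" "coprime (1 + m * j) n" by blast
  define k where "k = 1 + m * j"
  \<comment> \<open>The relation \<open>z = h(z ^ p)\<close> becomes the vanishing of
    \<open>h(x ^ p) - x\<close> at \<open>z\<close>, a form that transfers to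
    \<open>z ^ k\<close>.\<close>
  define P where "P = pcompose h (monom 1 p) - monom 1 1"
  have "coeffs_in \<rat> P"
    unfolding P_def using h(1) R by (intro coeffs_in_arith coeffs_in_pcompose coeffs_in_monom) auto
  moreover have "poly P z = 0" using h(2) by (simp add: P_def poly_pcompose poly_monom)
  ultimately have "poly P (z ^ k) = 0"
    using rat_poly_root_coprime_power[of n z k P] primitive_root_of_unityD[OF z] j
    by (simp add: k_def)
  then have e: "z ^ k = poly h ((z ^ k) ^ p)" by (simp add: P_def poly_pcompose poly_monom)
  have "(z ^ k) ^ p = z ^ p * (z ^ n) ^ j"
    by (simp add: k_def m power_add algebra_simps flip: power_mult)
  then have "(z ^ k) ^ p = z ^ p" using primitive_root_of_unityD[OF z] by simp
  then have "z ^ k = z" using e h(2) by simp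
  then have "z ^ (m * j) = 1" using primitive_root_of_unityD[OF z] by (simp add: k_def)
  moreover have "0 < m * j" "m * j < n" using j m m0 by auto
  ultimately show False using z by (auto simp: primitive_root_of_unity_def)
qed

subsection \<open>Real radicals in cyclotomic fields\<close>

text \<open>\<open>x ^ n - 1\<close> has \<open>n\<close> distinct roots, and the cofactor
  \<open>h\<close> accounts for at most \<open>degree h\<close> of them.\<close>

lemma card_roots_ge_degree:
  fixes G h :: "complex poly"
  assumes n: "n > 0" and G: "monom 1 n - 1 = G * h"
  shows "degree G \<le> card {w. poly G w = 0}"
proof -
  let ?U = "monom 1 n - 1 :: complex poly"
  have degU: "degree ?U = n"
    unfolding diff_conv_add_uminus using n
    by (subst degree_add_eq_left) (auto simp: degree_monom_eq)
  then have nz: "G \<noteq> 0" "h \<noteq> 0" using n G by auto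
  have "{w::complex. w ^ n = 1} = {w. poly (G * h) w = 0}"
    by (simp flip: G add: poly_monom)
  also have "\<dots> = {w. poly G w = 0} \<union> {w. poly h w = 0}" by auto
  finally have "n \<le> card {w. poly G w = 0} + card {w. poly h w = 0}"
    using card_Un_le card_roots_unity_eq[OF n] by metis
  moreover have "card {w. poly h w = 0} \<le> degree h" by (rule card_poly_roots_bound[OF nz(2)])
  moreover have "n = degree G + degree h" using degU G nz by (simp add: degree_mult_eq)
  ultimately show ?thesis by simp
qed

text \<open>Both sides are the inverse of \<open>w\<close>, which has norm 1. On roots of unity
  complex conjugation thus becomes a polynomial map, which can be carried from one conjugate to
  another.\<close>

lemma cnj_root_of_unity:
  fixes w :: complex
  assumes "n > 0" "w ^ n = 1"
  shows "w ^ (n - 1) = cnj w"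
proof -
  have "norm w = 1"
    using assms by (metis norm_power norm_one power_eq_1_iff norm_ge_zero gr0_implies_Suc nat.simps(3))
  then have "w * cnj w = 1" by (simp add: complex_norm_square[symmetric])
  moreover have "w ^ (n - 1) * w = 1" using assms power_minus_mult[of n w] by simp
  ultimately show ?thesis by (metis mult.assoc mult.commute mult_1)
qed

text \<open>Writing \<open>\<beta> = \<gamma>(z)\<close>, every conjugate \<open>\<gamma>(w)\<close> of \<open>\<beta>\<close> is real, since complex conjugation commutes with
  \<open>z \<mapsto> w\<close>, and is an \<open>r\<close>-th root of \<open>\<beta> ^ r\<close>. As \<open>r\<close> is odd, all conjugates coincide with \<open>\<beta>\<close>.\<close>

lemma real_odd_radical_in_cyclotomic_field:
  assumes n: "n > 0" and z: "z ^ n = 1" and b: "complex_of_real b \<in> simple_adjoin \<rat> z"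
    and r: "odd r" "complex_of_real (b ^ r) \<in> \<rat>"
  shows "complex_of_real b \<in> \<rat>"
proof -
  let ?b = "complex_of_real b"
  note R = subfield_ofD(1)[OF subfield_of_Rats[where 'a = complex]]
  obtain G where G: "coeffs_in \<int> G" "lead_coeff G = 1" "poly G z = 0"
    and Gmin: "\<And>p. coeffs_in \<rat> p \<Longrightarrow> poly p z = 0 \<Longrightarrow> G dvd p"
    using root_of_unity_int_min_poly[OF n z] by blast
  have GQ: "coeffs_in \<rat> G" using G(1) coeffs_in_mono Ints_subset_Rats by blast
  obtain g0 where g0: "coeffs_in \<rat> g0" "?b = poly g0 z" using b by (elim simple_adjoinE)
  obtain q g where g: "coeffs_in \<rat> g" "g0 = G * q + g" "g = 0 \<or> degree g < degree G"
    using monic_division[OF R GQ G(2) g0(1)] by blast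
  have gz: "poly g z = ?b" using g0(2) g(2) G(3) by simp
  have "coeffs_in \<rat> (monom 1 n - 1 :: complex poly)"
    using R by (auto intro!: coeffs_in_arith coeffs_in_monom)
  then have "G dvd monom 1 n - 1" using Gmin z by (simp add: poly_monom)
  then obtain h where h: "monom 1 n - 1 = G * h" by (elim dvdE)
  have conj: "poly g w = ?b" if w: "poly G w = 0" for w
  proof -
    have wn: "w ^ n = 1" using arg_cong[OF h, of "\<lambda>p. poly p w"] w by (simp add: poly_monom)
    have "coeffs_in \<rat> (g ^ r - [:?b ^ r:])"
      using g(1) r(2) R by (intro coeffs_in_arith coeffs_in_power) (auto simp: coeffs_in_pCons)
    then have "G dvd g ^ r - [:?b ^ r:]" using Gmin gz by simp
    then have "poly (g ^ r - [:?b ^ r:]) w = 0" using w by (metis dvd_trans poly_eq_0_iff_dvd)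
    then have pw: "poly g w ^ r = ?b ^ r" by simp
    \<comment> \<open>\<open>?t\<close> is \<open>g(x) - g(x ^ (n - 1))\<close>. At an
      \<open>n\<close>-th root of unity its vanishing says that the value of \<open>g\<close> there
      is real.\<close>
    let ?t = "g - pcompose g (monom 1 (n - 1))"
    have "coeffs_in \<rat> ?t"
      using g(1) R by (intro coeffs_in_arith coeffs_in_pcompose coeffs_in_monom) auto
    have cnjg: "cnj (poly g x) = poly g (cnj x)" for x
    proof -
      have "cnj (coeff g i) = coeff g i" for i
        using g(1)[unfolded coeffs_in_def, rule_format, of i] by (elim Rats_cases') simp
      then have "map_poly cnj g = g" by (intro poly_eqI) (simp add: coeff_map_poly)
      then show ?thesis by (metis poly_cnj)
    qed
    have "poly ?t z = 0"
      using gz cnjg[of z] by (simp add: poly_pcompose poly_monom cnj_root_of_unity[OF n z] del: One_nat_def)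
    then have "G dvd ?t" using Gmin \<open>coeffs_in \<rat> ?t\<close> by blast
    then have "poly ?t w = 0" using w by (metis dvd_trans poly_eq_0_iff_dvd)
    then have "poly g w = cnj (poly g w)"
      using cnjg[of w] by (simp add: poly_pcompose poly_monom cnj_root_of_unity[OF n wn] del: One_nat_def)
    then obtain s where s: "poly g w = complex_of_real s" by (metis Reals_cnj_iff Reals_cases)
    then have "s ^ r = b ^ r" using pw by (metis of_real_eq_iff of_real_power)
    then have "s = b" using r(1) by (metis odd_real_root_power_cancel)
    then show ?thesis using s by simp
  qed
  have degG: "degree G > 0"
  proof (rule ccontr)
    assume "\<not> degree G > 0"
    then obtain c where "G = [:c:]" by (auto elim: degree_eq_zeroE)
    then show False using G by auto
  qed
  \<comment> \<open>Every root of \<open>G\<close> is a root of this difference, and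
    \<open>G\<close> has at least \<open>degree G\<close> distinct roots, more than a nonzero
    polynomial of smaller degree allows.\<close>
  have "g - [:?b:] = 0"
  proof (rule ccontr)
    assume nz: "g - [:?b:] \<noteq> 0"
    have "{w. poly G w = 0} \<subseteq> {w. poly (g - [:?b:]) w = 0}" using conj by auto
    then have "card {w. poly G w = 0} \<le> card {w. poly (g - [:?b:]) w = 0}"
      using nz poly_roots_finite card_mono by blast
    then have "degree G \<le> degree (g - [:?b:])"
      using card_roots_ge_degree[OF n h] card_poly_roots_bound[OF nz] by linarith
    moreover have "degree (g - [:?b:]) < degree G"
      using g(3) degG by (intro degree_diff_less) auto
    ultimately show False by simp
  qed
  then have "coeff g 0 = ?b" by simp
  then show ?thesis using g(1) by (metis coeffs_in_def)
qed

section \<open>Roots of \<open>x ^ n - c\<close> over the cyclotomic field\<close>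

locale odd_radical =
  fixes n :: nat and c :: rat and \<zeta> a :: complex and f :: "rat poly"
  assumes n_gt_2: "n > 2" and odd_n: "odd n" and zeta: "primitive_root_of_unity n \<zeta>"
    and c_pos: "c > 0" and f_eq: "f = monom 1 n - [:c:]" and irreducible_f: "irreducible f"
    and a_eq: "a = complex_of_real (root n (of_rat c))"
begin

abbreviation cyc :: "complex set" where "cyc \<equiv> simple_adjoin \<rat> \<zeta>"

lemma n_pos: "n > 0" using n_gt_2 by simp

lemmas zeta_power_n = primitive_root_of_unityD(2)[OF zeta]
  and zeta_nonzero = primitive_root_of_unityD(3)[OF zeta]

lemma a_power_n: "a ^ n = of_rat c"
proof -
  have "root n (of_rat c) ^ n = (of_rat c :: real)" using n_pos c_pos by simp
  then have "a ^ n = complex_of_real (of_rat c)" using a_eq by (metis of_real_power)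
  also have "complex_of_real (of_rat c) = of_rat c" by (cases c) (simp add: of_rat_rat)
  finally show ?thesis .
qed

lemma a_nonzero: "a \<noteq> 0"
  using a_power_n c_pos n_pos by (auto simp: power_0_left)

lemma root_power_n: "(a * \<zeta> powi b) ^ n = of_rat c"
proof -
  have "(\<zeta> powi b) ^ n = 1"
    using zeta_power_n by (metis mult.commute power_int_1_left power_int_mult power_int_of_nat)
  then show ?thesis using a_power_n by (simp add: power_mult_distrib)
qed

lemma root_eq_iff: "a * \<zeta> powi b = a * \<zeta> powi b' \<longleftrightarrow> int n dvd b - b'"
  using a_nonzero primitive_root_powi_eq_iff[OF zeta] by simp

lemma complex_roots_eq: "complex_roots f = range (\<lambda>b. a * \<zeta> powi b)"
proof -
  have map: "map_poly of_rat f = (monom 1 n - [:of_rat c:] :: complex poly)"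
    by (rule poly_eqI) (simp add: f_eq coeff_map_poly coeff_pCons of_rat_diff split: nat.splits)
  have "z \<in> range (\<lambda>b. a * \<zeta> powi b)" if "z ^ n = of_rat c" for z
  proof -
    have "(z / a) ^ n = 1"
      using that a_power_n c_pos by (simp add: power_divide)
    then obtain k where "z / a = \<zeta> ^ k" using roots_of_unity_eq_powers[OF zeta] by auto
    then have "z = a * \<zeta> powi (int k)" using a_nonzero by (simp add: field_simps)
    then show ?thesis by blast
  qed
  then show ?thesis
    using root_power_n by (auto simp: complex_roots_def map poly_monom)
qed

lemma subfield_of_power_field: "subfield_of (simple_adjoin \<rat> (\<zeta> ^ k))"
proof (rule subfield_of_simple_adjoin[OF subfield_of_Rats])
  have "coeff (monom 1 n - 1 :: complex poly) n = 1" using n_pos by simp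
  then show "(monom 1 n - 1 :: complex poly) \<noteq> 0" by (metis coeff_0 zero_neq_one)
  show "coeffs_in \<rat> (monom 1 n - 1 :: complex poly)"
    using subfield_ofD(1)[OF subfield_of_Rats] by (auto intro!: coeffs_in_arith coeffs_in_monom)
  show "poly (monom 1 n - 1) (\<zeta> ^ k) = 0"
    using zeta_power_n by (simp add: poly_monom) (metis mult.commute power_mult power_one)
qed

lemma subfield_of_cyc: "subfield_of cyc"
  using subfield_of_power_field[of 1] by simp

lemmas subring_of_cyc = subfield_ofD(1)[OF subfield_of_cyc]

lemma of_rat_in_subfield: "subfield_of K \<Longrightarrow> (of_rat x :: complex) \<in> K"
  using Rats_subset_subfield_of by fastforce

text \<open>Since \<open>a ^ n\<close> is rational, Bezout moves membership from
  \<open>a ^ e\<close> to \<open>a ^ d\<close> with \<open>d = gcd e n\<close>. This is a real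
  number whose odd power with exponent \<open>r = n / d\<close> is rational, so it is itself a
  rational \<open>b\<close>. Then \<open>c = b ^ r\<close>, and \<open>x ^ d - b\<close> is a proper
  factor of \<open>f\<close>.\<close>

lemma a_power_notin_cyc:
  assumes "0 < e" "e < n"
  shows "a ^ e \<notin> cyc"
proof
  assume e: "a ^ e \<in> cyc"
  define d where "d = gcd e n"
  obtain r where r: "n = d * r" by (metis d_def gcd_dvd2 dvdE)
  have "d \<le> e" using assms by (auto simp: d_def intro: gcd_le1_nat)
  moreover have "0 < d" using assms by (simp add: d_def)
  ultimately have d: "0 < d" "d < n" using assms(2) by simp_all
  obtain u v where uv: "u * int e + v * int n = int d"
    using bezout_int[of "int e" "int n"] by (auto simp: d_def)
  have "a ^ d = a powi (int e * u + int n * v)" using uv by (simp add: mult.commute)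
  also have "\<dots> = (a ^ e) powi u * (a ^ n) powi v"
    using a_nonzero by (simp add: power_int_add power_int_mult)
  also have "\<dots> \<in> cyc"
    using e a_power_n of_rat_in_subfield[OF subfield_of_cyc]
    by (auto intro!: subring_ofD(6)[OF subring_of_cyc] subfield_of_powi[OF subfield_of_cyc])
  finally have "complex_of_real (root n (of_rat c) ^ d) \<in> cyc" by (simp add: a_eq)
  moreover have "complex_of_real ((root n (of_rat c) ^ d) ^ r) \<in> \<rat>"
    using a_power_n by (simp add: a_eq r power_mult)
  moreover have "odd r" using odd_n r by simp
  ultimately have "complex_of_real (root n (of_rat c) ^ d) \<in> \<rat>"
    using real_odd_radical_in_cyclotomic_field[OF n_pos zeta_power_n] by blast
  then obtain b where b: "a ^ d = of_rat b" by (auto simp: a_eq elim: Rats_cases)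
  have "(of_rat (b ^ r) :: complex) = of_rat c"
    using a_power_n by (simp add: of_rat_power r power_mult flip: b)
  then have br: "c = b ^ r" by (metis of_rat_eq_iff)
  have "f = monom 1 d ^ r - [:b:] ^ r"
    by (simp add: f_eq br r monom_power poly_const_pow)
  then obtain q where q: "f = (monom 1 d - [:b:]) * q"
    using power_diff_sumr2[of "monom 1 d" r "[:b:]"] by metis
  have dd: "degree (monom 1 d - [:b:]) = d"
    unfolding diff_conv_add_uminus using d
    by (subst degree_add_eq_left) (auto simp: degree_monom_eq)
  have dn: "degree f = n"
    unfolding f_eq diff_conv_add_uminus using n_pos
    by (subst degree_add_eq_left) (auto simp: degree_monom_eq)
  have "is_unit (monom 1 d - [:b:]) \<or> is_unit q"
    using irreducible_f q irreducibleD by blast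
  then have "degree (monom 1 d - [:b:]) = 0 \<or> degree q = 0"
    using is_unit_iff_degree by (metis degree_0 is_unit_iff_degree)
  moreover have "n = d + degree q"
    using q dn dd n_pos degree_mult_eq[of "monom 1 d - [:b:]" q] by (metis degree_0 mult_eq_0_iff less_irrefl)
  ultimately show False using d dd by auto
qed

text \<open>The constant coefficient of the minimal polynomial of a root over \<open>\<rat>(\<zeta>)\<close>, of degree \<open>d\<close>, is up to
  sign a product of \<open>d\<close> roots of \<open>f\<close>, hence \<open>a ^ d\<close> up to a power of \<open>\<zeta>\<close>.\<close>

lemma root_independent_over_cyc:
  assumes "coeffs_in cyc g" "degree g < n" "poly g (a * \<zeta> powi b) = 0"
  shows "g = 0"
proof (rule ccontr)
  assume "g \<noteq> 0"
  define \<alpha> where "\<alpha> = a * \<zeta> powi b"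
  obtain h where h: "coeffs_in cyc h" "h \<noteq> 0" "poly h \<alpha> = 0" "degree h \<le> degree g"
    and hmin: "\<And>p. coeffs_in cyc p \<Longrightarrow> poly p \<alpha> = 0 \<Longrightarrow> degree p < degree h \<Longrightarrow> p = 0"
    using ex_min_poly[OF assms(1) \<open>g \<noteq> 0\<close>] assms(3) by (metis \<alpha>_def)
  define d where "d = degree h"
  have d: "0 < d" "d < n"
  proof -
    show "d < n" using h(4) assms(2) by (simp add: d_def)
    show "0 < d"
    proof (rule ccontr)
      assume "\<not> 0 < d"
      then obtain k where "h = [:k:]" by (auto simp: d_def elim: degree_eq_zeroE)
      then show False using h by simp
    qed
  qed
  have "coeffs_in cyc (monom 1 n - [:of_rat c:])"
    using subring_of_cyc of_rat_in_subfield[OF subfield_of_cyc]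
    by (intro coeffs_in_arith coeffs_in_monom) (auto simp: coeffs_in_pCons subring_ofD)
  then obtain q r where qr: "coeffs_in cyc r" "monom 1 n - [:of_rat c:] = h * q + r"
    "r = 0 \<or> degree r < degree h"
    using subfield_division[OF subfield_of_cyc h(1,2)] by blast
  have "poly r \<alpha> = 0"
    using arg_cong[OF qr(2), of "\<lambda>p. poly p \<alpha>"] h(3) root_power_n by (simp add: poly_monom \<alpha>_def)
  then have "r = 0" using hmin[OF qr(1)] qr(3) by blast
  then have hq: "monom 1 n - [:of_rat c:] = h * q" using qr by simp
  \<comment> \<open>As \<open>h\<close> divides \<open>x ^ n - c\<close>, each of its complex roots
    \<open>\<rho> i\<close> is an \<open>n\<close>-th root of \<open>c\<close>.\<close>
  obtain \<rho> where \<rho>: "smult (lead_coeff h) (\<Prod>i<d. [:- \<rho> i, 1:]) = h"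
    using complex_poly_decompose'[of h] by (metis d_def)
  have \<rho>n: "\<rho> i ^ n = of_rat c" if "i < d" for i
  proof -
    have "poly (\<Prod>i<d. [:- \<rho> i, 1:]) (\<rho> i) = 0"
      unfolding poly_prod using that by (intro prod_zero) auto
    then have "poly h (\<rho> i) = 0" by (metis \<rho> mult_zero_right poly_smult)
    then show ?thesis using arg_cong[OF hq, of "\<lambda>p. poly p (\<rho> i)"] by (simp add: poly_monom)
  qed
  define t where "t = (\<Prod>i<d. - \<rho> i)"
  have "poly h 0 = lead_coeff h * t"
    by (subst \<rho>[symmetric]) (simp add: poly_prod t_def)
  then have "t = coeff h 0 / lead_coeff h" using h(2) by (simp add: poly_0_coeff_0)
  then have t: "t \<in> cyc"
    using h(1) subfield_of_divide[OF subfield_of_cyc] by (simp add: coeffs_in_def)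
  \<comment> \<open>Because \<open>n\<close> is odd, signs pass through the \<open>n\<close>-th
    power. So \<open>t\<close> and \<open>(- a) ^ d\<close> have the same \<open>n\<close>-th power
    and differ by a power of \<open>\<zeta>\<close>.\<close>
  have "t ^ n = (\<Prod>i<d. - of_rat c)"
    unfolding t_def prod_power_distrib using \<rho>n odd_n by (intro prod.cong) auto
  also have "\<dots> = (- (a ^ n)) ^ d" by (simp add: a_power_n)
  also have "\<dots> = ((- a) ^ n) ^ d" using odd_n by simp
  also have "\<dots> = ((- a) ^ d) ^ n" by (metis power_mult mult.commute)
  finally have tn: "t ^ n = ((- a) ^ d) ^ n" .
  have "((- a) ^ d) ^ n \<noteq> 0" using a_nonzero by simp
  then have "((- a) ^ d / t) ^ n = 1" using tn by (simp add: power_divide)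
  then obtain k where "(- a) ^ d / t = \<zeta> ^ k" using roots_of_unity_eq_powers[OF zeta] by auto
  moreover have "t \<noteq> 0" using tn a_nonzero n_pos by (auto simp: power_0_left)
  ultimately have "(- a) ^ d = \<zeta> ^ k * t" by (simp add: field_simps)
  also have "\<dots> \<in> cyc"
    using t subring_of_cyc subfield_ofD(1)[OF subfield_of_Rats]
    by (intro subring_ofD(6) subring_of_power generator_in_simple_adjoin)
  finally have "(- a) ^ d \<in> cyc" .
  moreover have "(- 1) ^ d \<in> cyc"
    using subring_of_cyc by (intro subring_of_power) (auto intro: subring_ofD)
  ultimately have "(- 1) ^ d * (- a) ^ d \<in> cyc" by (intro subring_ofD(6)[OF subring_of_cyc])
  then have "a ^ d \<in> cyc" by (simp flip: power_mult_distrib)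
  then show False using a_power_notin_cyc d by blast
qed

section \<open>The criterion for generating the splitting field\<close>

lemma zeta_notin_rat_adjoin_congruent:
  assumes p: "prime p" "p dvd n" and B: "\<And>b. b \<in> B \<Longrightarrow> int p dvd b - b0"
  shows "\<zeta> \<notin> rat_adjoin ((\<lambda>b. a * \<zeta> powi b) ` B)"
proof
  assume *: "\<zeta> \<in> rat_adjoin ((\<lambda>b. a * \<zeta> powi b) ` B)"
  define \<alpha> where "\<alpha> = a * \<zeta> powi b0"
  define L where "L = simple_adjoin \<rat> (\<zeta> ^ p)"
  have L: "subfield_of L" unfolding L_def by (rule subfield_of_power_field)
  note RL = subfield_ofD(1)[OF L]
  note RQ = subfield_ofD(1)[OF subfield_of_Rats]
  have Lcyc: "L \<subseteq> cyc"
    unfolding L_def using subring_of_cyc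
    by (intro simple_adjoin_subset subset_simple_adjoin subring_of_power
        generator_in_simple_adjoin RQ)
  define U where "U = (monom 1 n - [:of_rat c:] :: complex poly)"
  have U: "coeffs_in L U"
    unfolding U_def using RL of_rat_in_subfield[OF L]
    by (intro coeffs_in_arith coeffs_in_monom) (auto simp: coeffs_in_pCons subring_ofD)
  have degU: "degree U = n"
    unfolding U_def diff_conv_add_uminus using n_pos
    by (subst degree_add_eq_left) (auto simp: degree_monom_eq)
  have U1: "lead_coeff U = 1"
    unfolding degU using n_pos by (auto simp: U_def coeff_pCons split: nat.splits)
  have U\<alpha>: "poly U \<alpha> = 0" using root_power_n by (simp add: U_def \<alpha>_def poly_monom)
  have U0: "U \<noteq> 0" using U1 by auto
  define E where "E = simple_adjoin L \<alpha>"
  have E: "subfield_of E" unfolding E_def by (rule subfield_of_simple_adjoin[OF L U U0 U\<alpha>])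
  have "a * \<zeta> powi b \<in> E" if "b \<in> B" for b
  proof -
    obtain m where m: "b - b0 = int p * m" using B[OF \<open>b \<in> B\<close>] by (elim dvdE)
    have "a * \<zeta> powi b = \<alpha> * (\<zeta> ^ p) powi m"
      using zeta_nonzero m
      by (simp add: \<alpha>_def power_int_power flip: m power_int_add)
    moreover have "(\<zeta> ^ p) powi m \<in> E"
      using subset_simple_adjoin[OF RL, of \<alpha>] generator_in_simple_adjoin[OF RQ, of "\<zeta> ^ p"]
        subfield_of_powi[OF E] by (auto simp: E_def L_def)
    moreover have "\<alpha> \<in> E" unfolding E_def by (rule generator_in_simple_adjoin[OF RL])
    ultimately show ?thesis using subring_ofD(6)[OF subfield_ofD(1)[OF E]] by simp
  qed
  then have "rat_adjoin ((\<lambda>b. a * \<zeta> powi b) ` B) \<subseteq> E" by (intro rat_adjoin_least[OF E]) auto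
  then obtain g where g: "coeffs_in L g" "\<zeta> = poly g \<alpha>" using * by (auto simp: E_def elim: simple_adjoinE)
  \<comment> \<open>Reduction modulo \<open>U\<close> brings the degree below \<open>n\<close> and
    keeps the coefficients in \<open>L\<close>. Independence over the larger field
    \<open>cyc\<close> then gives \<open>r = [:\<zeta>:]\<close>, so \<open>\<zeta>\<close> is a
    coefficient of \<open>r\<close>.\<close>
  obtain q r where qr: "coeffs_in L r" "g = U * q + r" "r = 0 \<or> degree r < n"
    using monic_division[OF RL U U1 g(1)] degU by auto
  have "coeffs_in cyc (r - [:\<zeta>:])"
    using coeffs_in_mono[OF qr(1) Lcyc] subring_of_cyc generator_in_simple_adjoin[OF RQ, of \<zeta>]
    by (intro coeffs_in_arith) (auto simp: coeffs_in_pCons)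
  moreover have "degree (r - [:\<zeta>:]) < n"
    using qr(3) n_pos by (intro degree_diff_less) auto
  moreover have "poly (r - [:\<zeta>:]) (a * \<zeta> powi b0) = 0"
    using g(2) qr(2) U\<alpha> by (simp add: \<alpha>_def)
  ultimately have "r - [:\<zeta>:] = 0" using root_independent_over_cyc by blast
  then have "\<zeta> = coeff r 0" by simp
  then have "\<zeta> \<in> L" using qr(1) by (metis coeffs_in_def)
  then show False
    using primitive_root_notin_prime_power_field[OF zeta odd_n p] by (simp add: L_def)
qed

lemma zeta_in_splitting_field: "\<zeta> \<in> rat_splitting_field f"
proof -
  have "{a * \<zeta> powi 0, a * \<zeta> powi 1} \<subseteq> rat_splitting_field f"
    unfolding rat_splitting_field_def using subset_rat_adjoin complex_roots_eq by blast
  then have "(a * \<zeta> powi 1) / (a * \<zeta> powi 0) \<in> rat_splitting_field f"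
    unfolding rat_splitting_field_def by (intro subfield_of_divide subfield_of_rat_adjoin) auto
  then show ?thesis using a_nonzero by simp
qed

text \<open>The integers \<open>k\<close> with \<open>\<zeta> powi k\<close> in the generated field
  form a group, generated by its least positive element \<open>d\<close>. It contains
  \<open>n\<close> and, through quotients of roots, every difference of exponents in
  \<open>B\<close>; so a prime divisor of \<open>d\<close> would contradict
  \<open>sep\<close>.\<close>

lemma zeta_in_rat_adjoin:
  assumes sep: "\<And>p. prime p \<Longrightarrow> p dvd n \<Longrightarrow> \<exists>b\<in>B. \<exists>b'\<in>B. \<not> int p dvd b - b'"
  shows "\<zeta> \<in> rat_adjoin ((\<lambda>b. a * \<zeta> powi b) ` B)"
proof -
  define K where "K = rat_adjoin ((\<lambda>b. a * \<zeta> powi b) ` B)"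
  have K: "subfield_of K" unfolding K_def by (rule subfield_of_rat_adjoin)
  note R = subfield_ofD(1)[OF K]
  define d where "d = (LEAST d::nat. d > 0 \<and> \<zeta> ^ d \<in> K)"
  have "n > 0 \<and> \<zeta> ^ n \<in> K" using n_pos zeta_power_n subring_ofD(1)[OF R] by simp
  then have d: "d > 0" "\<zeta> ^ d \<in> K"
    unfolding d_def by (metis (mono_tags, lifting) LeastI)+
  have dmin: "d \<le> e" if "e > 0" "\<zeta> ^ e \<in> K" for e
    unfolding d_def using that by (intro Least_le) simp
  have dvd: "int d dvd k" if k: "\<zeta> powi k \<in> K" for k
  proof -
    have "\<zeta> ^ nat (k mod int d) = \<zeta> powi (k - int d * (k div int d))"
      using d(1) by (simp add: power_int_nonneg_exp minus_mult_div_eq_mod)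
    also have "\<dots> = \<zeta> powi k / (\<zeta> ^ d) powi (k div int d)"
      using zeta_nonzero by (simp add: power_int_diff power_int_mult)
    also have "\<dots> \<in> K" by (rule subfield_of_divide[OF K k subfield_of_powi[OF K d(2)]])
    finally have *: "\<zeta> ^ nat (k mod int d) \<in> K" .
    have "nat (k mod int d) < d" using d(1) by (simp add: nat_less_iff)
    then have "nat (k mod int d) = 0" using dmin[OF _ *] by force
    then have "k mod int d = 0" using d(1) pos_mod_sign[of "int d" k] by linarith
    then show ?thesis by (simp add: dvd_eq_mod_eq_0)
  qed
  have "d = 1"
  proof (rule ccontr)
    assume "d \<noteq> 1"
    then obtain p where p: "prime p" "p dvd d" using prime_factor_nat by blast
    have "\<zeta> powi (int n) \<in> K" using zeta_power_n subring_ofD(1)[OF R] by simp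
    then have "p dvd n" using dvd p(2) by (metis dvd_trans int_dvd_int_iff)
    then obtain b b' where b: "b \<in> B" "b' \<in> B" "\<not> int p dvd b - b'" using sep p(1) by blast
    have "a * \<zeta> powi b \<in> K" "a * \<zeta> powi b' \<in> K"
      unfolding K_def using b by (auto intro!: subsetD[OF subset_rat_adjoin])
    then have "(a * \<zeta> powi b) / (a * \<zeta> powi b') \<in> K" using K by (intro subfield_of_divide)
    then have "\<zeta> powi (b - b') \<in> K" using a_nonzero zeta_nonzero by (simp add: power_int_diff)
    then have "int d dvd b - b'" by (rule dvd)
    then show False using b(3) p(2) by (meson dvd_trans int_dvd_int_iff)
  qed
  then show ?thesis using d(2) by (simp add: K_def)
qed

text \<open>The splitting field contains \<open>\<zeta>\<close>, which excludes congruent exponents.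
  Conversely, \<open>\<zeta>\<close> and a single root yield \<open>a\<close>, hence all
  roots.\<close>

lemma generating_set_iff:
  "generating_set f ((\<lambda>b. a * \<zeta> powi b) ` B) \<longleftrightarrow>
    (\<forall>p. prime p \<and> p dvd n \<longrightarrow> (\<exists>b\<in>B. \<exists>b'\<in>B. \<not> int p dvd b - b'))"
proof
  assume gen: "generating_set f ((\<lambda>b. a * \<zeta> powi b) ` B)"
  show "\<forall>p. prime p \<and> p dvd n \<longrightarrow> (\<exists>b\<in>B. \<exists>b'\<in>B. \<not> int p dvd b - b')"
  proof (intro allI impI, rule ccontr)
    fix p assume p: "prime p \<and> p dvd n" and "\<not> (\<exists>b\<in>B. \<exists>b'\<in>B. \<not> int p dvd b - b')"
    \<comment> \<open>Any element of \<open>B\<close> serves as \<open>b0\<close>; for empty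
      \<open>B\<close> any integer does.\<close>
    then obtain b0 where "\<And>b. b \<in> B \<Longrightarrow> int p dvd b - b0" by (metis all_not_in_conv)
    then have "\<zeta> \<notin> rat_adjoin ((\<lambda>b. a * \<zeta> powi b) ` B)"
      using zeta_notin_rat_adjoin_congruent p by blast
    then show False using gen zeta_in_splitting_field by (simp add: generating_set_def)
  qed
next
  assume sep: "\<forall>p. prime p \<and> p dvd n \<longrightarrow> (\<exists>b\<in>B. \<exists>b'\<in>B. \<not> int p dvd b - b')"
  define K where "K = rat_adjoin ((\<lambda>b. a * \<zeta> powi b) ` B)"
  have K: "subfield_of K" unfolding K_def by (rule subfield_of_rat_adjoin)
  have z: "\<zeta> \<in> K" unfolding K_def using zeta_in_rat_adjoin sep by blast
  obtain p where "prime p" "p dvd n" using n_gt_2 prime_factor_nat[of n] by auto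
  then obtain b where "b \<in> B" using sep by blast
  then have "a * \<zeta> powi b \<in> K" unfolding K_def by (intro subsetD[OF subset_rat_adjoin]) auto
  then have "a * \<zeta> powi b / \<zeta> powi b \<in> K" using K z by (intro subfield_of_divide subfield_of_powi)
  then have "a \<in> K" using zeta_nonzero by simp
  then have "complex_roots f \<subseteq> K"
    using K z by (auto simp: complex_roots_eq intro!: subring_ofD(6) subfield_ofD(1) subfield_of_powi)
  then have "rat_splitting_field f \<subseteq> K"
    unfolding rat_splitting_field_def by (rule rat_adjoin_least[OF K])
  moreover have sub: "(\<lambda>b. a * \<zeta> powi b) ` B \<subseteq> complex_roots f" by (auto simp: complex_roots_eq)
  then have "K \<subseteq> rat_splitting_field f"
    unfolding K_def rat_splitting_field_def by (rule rat_adjoin_mono)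
  ultimately show "generating_set f ((\<lambda>b. a * \<zeta> powi b) ` B)"
    using sub by (auto simp: generating_set_def K_def)
qed

end

subsection \<open>Combinatorics of generating sets\<close>

text \<open>Translation by \<open>- k\<close> modulo \<open>n\<close> is a bijection onto the
  residues prime to \<open>n\<close>; it is written as adding \<open>n - k\<close> to stay within
  the natural numbers.\<close>

lemma card_coprime_shift_eq_totient:
  assumes n: "n > 1" and k: "k < n"
  shows "card {l. l < n \<and> coprime (int l - int k) (int n)} = totient n"
proof -
  \<comment> \<open>Totatives range over \<open>1\<close> to \<open>n\<close>, residues over
    \<open>0\<close> to \<open>n - 1\<close>; for \<open>n > 1\<close> neither end is coprime to
    \<open>n\<close>.\<close>
  have "totatives n = {x. x < n \<and> coprime x n}"
  proof (intro equalityI subsetI)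
    fix x assume "x \<in> totatives n"
    then show "x \<in> {x. x < n \<and> coprime x n}" using n by (auto simp: in_totatives_iff totatives_less)
  next
    fix x assume "x \<in> {x. x < n \<and> coprime x n}"
    then show "x \<in> totatives n" using n by (cases x) (auto simp: in_totatives_iff)
  qed
  moreover have "bij_betw (\<lambda>l. (l + (n - k)) mod n)
    {l. l < n \<and> coprime (int l - int k) (int n)} {x. x < n \<and> coprime x n}"
  proof (rule bij_betwI[where g = "\<lambda>x. (x + k) mod n"])
    have cop: "coprime (y mod n) n \<longleftrightarrow> coprime (int y) (int n)" for y
      by (simp add: coprime_iff_gcd_eq_1 gcd_red_nat[symmetric] gcd.commute)
    have cop': "coprime x (int n) \<longleftrightarrow> coprime y (int n)" if "[x = y] (mod int n)" for x y
      using that by (metis cong_imp_coprime cong_sym)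
    show "(\<lambda>l. (l + (n - k)) mod n) \<in> {l. l < n \<and> coprime (int l - int k) (int n)} \<rightarrow> {x. x < n \<and> coprime x n}"
    proof
      fix l assume l: "l \<in> {l. l < n \<and> coprime (int l - int k) (int n)}"
      have e: "int (l + (n - k)) = int l - int k + int n" using k by simp
      have "[int (l + (n - k)) = int l - int k] (mod int n)"
        unfolding cong_def e by (rule mod_add_self2)
      then have "coprime (int (l + (n - k))) (int n)" using cop' l by blast
      then show "(l + (n - k)) mod n \<in> {x. x < n \<and> coprime x n}"
        using n cop[of "l + (n - k)"] by simp
    qed
    show "(\<lambda>x. (x + k) mod n) \<in> {x. x < n \<and> coprime x n} \<rightarrow> {l. l < n \<and> coprime (int l - int k) (int n)}"
    proof
      fix x assume x: "x \<in> {x. x < n \<and> coprime x n}"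
      have "[int ((x + k) mod n) - int k = int x] (mod int n)"
        by (simp add: cong_def zmod_int mod_diff_left_eq)
      then show "(x + k) mod n \<in> {l. l < n \<and> coprime (int l - int k) (int n)}"
        using x n cop' by auto
    qed
    show "((l + (n - k)) mod n + k) mod n = l" if "l \<in> {l. l < n \<and> coprime (int l - int k) (int n)}" for l
      using that k by (simp add: mod_add_left_eq)
    show "((x + k) mod n + (n - k)) mod n = x" if "x \<in> {x. x < n \<and> coprime x n}" for x
    proof -
      have "((x + k) mod n + (n - k)) mod n = (x + k + (n - k)) mod n" by (rule mod_add_left_eq)
      also have "\<dots> = x" using that k by simp
      finally show ?thesis .
    qed
  qed
  ultimately show ?thesis by (simp add: totient_def bij_betw_same_card)
qed

text \<open>Counts ordered pairs, each unordered pair twice.\<close>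

lemma card_coprime_difference_pairs:
  assumes n: "n > 1"
  shows "2 * card {(k, l). k < l \<and> l < n \<and> coprime (l - k) n} = n * totient n"
proof -
  define S where "S = {(k, l). k < l \<and> l < n \<and> coprime (l - k) n}"
  define T where "T = (SIGMA k:{..<n}. {l. l < n \<and> coprime (int l - int k) (int n)})"
  have fin: "finite S"
    by (rule finite_subset[of _ "{..<n} \<times> {..<n}"]) (auto simp: S_def)
  have up: "coprime (int l - int k) (int n) \<longleftrightarrow> coprime (l - k) n" if "k < l" for k l
    using that by (metis coprime_int_iff less_imp_le of_nat_diff)
  have down: "coprime (int k - int l) (int n) \<longleftrightarrow> coprime (l - k) n" if "k < l" for k l
    using up[OF that] by (metis coprime_minus_left_iff minus_diff_eq)
  have "T = S \<union> prod.swap ` S"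
  proof (intro equalityI subsetI)
    fix x assume "x \<in> T"
    then obtain k l where x: "x = (k, l)" "k < n" "l < n" "coprime (int l - int k) (int n)"
      by (auto simp: T_def)
    have "k \<noteq> l" using x(4) n by auto
    then consider "k < l" | "l < k" by linarith
    then show "x \<in> S \<union> prod.swap ` S"
    proof cases
      case 1
      then show ?thesis using x up[OF 1] by (simp add: S_def)
    next
      case 2
      then have "(l, k) \<in> S" using x down[OF 2] by (simp add: S_def)
      then show ?thesis using x(1) by force
    qed
  next
    fix x assume "x \<in> S \<union> prod.swap ` S"
    then show "x \<in> T" by (auto simp: T_def S_def up down)
  qed
  moreover have "S \<inter> prod.swap ` S = {}" by (auto simp: S_def)
  moreover have "card (prod.swap ` S) = card S" by (intro card_image) (auto simp: inj_on_def)
  ultimately have "card T = 2 * card S" using fin by (simp add: card_Un_disjoint)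
  moreover have "card T = n * totient n"
    unfolding T_def using card_coprime_shift_eq_totient[OF n] by simp
  ultimately show ?thesis by (simp add: S_def)
qed

section \<open>From residues of exponents to the four claims\<close>

context odd_radical
begin

abbreviation rt :: "int \<Rightarrow> complex" where "rt b \<equiv> a * \<zeta> powi b"

definition separated :: "int set \<Rightarrow> bool" where
  "separated B \<longleftrightarrow> (\<forall>p. prime p \<and> p dvd n \<longrightarrow> (\<exists>b\<in>B. \<exists>b'\<in>B. \<not> int p dvd b - b'))"

lemma generating_iff_separated: "generating_set f (rt ` B) \<longleftrightarrow> separated B"
  unfolding separated_def by (rule generating_set_iff)

lemma separatedD:
  assumes "separated B" "prime p" "p dvd n"
  obtains b b' where "b \<in> B" "b' \<in> B" "\<not> int p dvd b - b'"
  using assms unfolding separated_def by blast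

text \<open>A subset of a set of roots again consists of roots, so failing to generate is a
  condition on the field alone.\<close>

lemma minimal_generating_iff:
  "minimal_generating_set f C \<longleftrightarrow> generating_set f C \<and> (\<forall>A. A \<subset> C \<longrightarrow> \<not> generating_set f A)"
  unfolding minimal_generating_set_def generating_set_def by blast

lemma generating_set_obtain:
  assumes "generating_set f C"
  obtains B where "C = rt ` B" "separated B"
proof -
  have "C \<subseteq> range rt" using assms complex_roots_eq by (simp add: generating_set_def)
  then obtain B where "C = rt ` B" by (auto elim: subset_imageE)
  then show thesis using that assms generating_iff_separated by blast
qed

lemma inj_on_root_powers: "inj_on (\<lambda>k. a * \<zeta> ^ k) {..<n}"
proof (rule inj_onI)
  fix i j assume ij: "i \<in> {..<n}" "j \<in> {..<n}" "a * \<zeta> ^ i = a * \<zeta> ^ j"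
  then have "rt (int i) = rt (int j)" by simp
  then have "int n dvd int i - int j" using root_eq_iff by blast
  then show "i = j" using ij(1,2) dvd_imp_le_int[of "int i - int j" "int n"] by fastforce
qed

lemma complex_roots_eq_powers: "complex_roots f = (\<lambda>k. a * \<zeta> ^ k) ` {..<n}"
proof (intro equalityI subsetI)
  fix x assume "x \<in> complex_roots f"
  then obtain b where b: "x = rt b" by (auto simp: complex_roots_eq)
  define k where "k = nat (b mod int n)"
  have "int n dvd b - int k" using n_pos by (simp add: k_def)
  then have "rt b = rt (int k)" using root_eq_iff by blast
  moreover have "k < n" using n_pos by (simp add: k_def nat_less_iff)
  ultimately show "x \<in> (\<lambda>k. a * \<zeta> ^ k) ` {..<n}" using b by auto
next
  fix x assume "x \<in> (\<lambda>k. a * \<zeta> ^ k) ` {..<n}"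
  then obtain k where "x = rt (int k)" by auto
  then show "x \<in> complex_roots f" unfolding complex_roots_eq by (rule range_eqI)
qed

lemma finite_generating_set: "generating_set f C \<Longrightarrow> finite C"
  unfolding generating_set_def complex_roots_eq_powers by (auto intro: finite_subset)

text \<open>A single prime divisor of \<open>n\<close> already demands two incongruent exponents,
  which give distinct roots.\<close>

lemma generating_card_ge_2:
  assumes "generating_set f C"
  shows "2 \<le> card C"
proof -
  obtain B where B: "C = rt ` B" "separated B" using generating_set_obtain[OF assms] .
  obtain p where p: "prime p" "p dvd n" using n_gt_2 prime_factor_nat[of n] by auto
  obtain b b' where b: "b \<in> B" "b' \<in> B" "\<not> int p dvd b - b'" using separatedD[OF B(2) p] .
  have "\<not> int n dvd b - b'" using b(3) p(2) by (meson dvd_trans int_dvd_int_iff)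
  then have ne: "rt b \<noteq> rt b'" using root_eq_iff by blast
  have "card {rt b, rt b'} \<le> card C"
    using b B(1) finite_generating_set[OF assms] by (intro card_mono) auto
  then show ?thesis using ne by simp
qed

lemma generating_pair_iff:
  assumes "k < l"
  shows "generating_set f {a * \<zeta> ^ k, a * \<zeta> ^ l} \<longleftrightarrow> coprime (l - k) n"
proof -
  have "separated {int k, int l} \<longleftrightarrow> (\<forall>p. prime p \<and> p dvd n \<longrightarrow> \<not> p dvd l - k)"
  proof -
    have "int p dvd int l - int k \<longleftrightarrow> p dvd l - k" for p
      using assms by (metis int_dvd_int_iff less_imp_le of_nat_diff)
    moreover have "int p dvd int k - int l \<longleftrightarrow> int p dvd int l - int k" for p
      by (metis dvd_minus_iff minus_diff_eq)
    ultimately show ?thesis by (simp add: separated_def)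
  qed
  also have "\<dots> \<longleftrightarrow> coprime (l - k) n"
    unfolding coprime_iff_no_common_prime by blast
  finally show ?thesis
    using generating_iff_separated[of "{int k, int l}"] by simp
qed

text \<open>Two is the least size of a generating set and is attained by the exponents
  \<open>0\<close> and \<open>1\<close>. A generating pair is automatically minimal, since its
  proper subsets are too small.\<close>

lemma shortest_iff: "shortest_minimal_generating_set f C \<longleftrightarrow> generating_set f C \<and> card C = 2"
proof -
  have minimal: "minimal_generating_set f D" if D: "generating_set f D" "card D = 2" for D
    unfolding minimal_generating_iff
  proof (intro conjI allI impI D(1))
    fix A assume "A \<subset> D"
    then have "card A < 2" using D finite_generating_set psubset_card_mono by metis
    then show "\<not> generating_set f A" using generating_card_ge_2[of A] by auto
  qed
  have "card {a * \<zeta> ^ 0, a * \<zeta> ^ 1} = 2"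
    using inj_onD[OF inj_on_root_powers, of 0 1] n_gt_2 by (auto simp: card_insert_if)
  moreover have "generating_set f {a * \<zeta> ^ 0, a * \<zeta> ^ 1}"
    using generating_pair_iff[of 0 1] by simp
  ultimately have ex: "\<exists>D. minimal_generating_set f D \<and> card D = 2" using minimal by blast
  show ?thesis
  proof
    assume C: "shortest_minimal_generating_set f C"
    obtain D where "minimal_generating_set f D" "card D = 2" using ex by blast
    then have "card C \<le> 2" "generating_set f C"
      using C unfolding shortest_minimal_generating_set_def minimal_generating_iff by metis+
    then show "generating_set f C \<and> card C = 2" using generating_card_ge_2[of C] by simp
  next
    assume "generating_set f C \<and> card C = 2"
    then show "shortest_minimal_generating_set f C"
      using minimal[of C] generating_card_ge_2
      unfolding shortest_minimal_generating_set_def minimal_generating_iff by metis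
  qed
qed

lemma shortest_pair_iff:
  assumes "k < l" "l < n"
  shows "shortest_minimal_generating_set f {a * \<zeta> ^ k, a * \<zeta> ^ l} \<longleftrightarrow> coprime (l - k) n"
proof -
  have "a * \<zeta> ^ k \<noteq> a * \<zeta> ^ l" using inj_onD[OF inj_on_root_powers, of k l] assms by auto
  then show ?thesis using generating_pair_iff[OF assms(1)] by (simp add: shortest_iff)
qed

text \<open>Ordering the two exponents below \<open>n\<close> identifies shortest sets with the
  pairs counted by \<open>card_coprime_difference_pairs\<close>.\<close>

lemma card_shortest: "real (card {B. shortest_minimal_generating_set f B}) = real n * real (totient n) / 2"
proof -
  define S where "S = {(k, l). k < l \<and> l < n \<and> coprime (l - k) n}"
  define g where "g = (\<lambda>(k, l). {a * \<zeta> ^ k, a * \<zeta> ^ l})"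
  have eq: "{B. shortest_minimal_generating_set f B} = g ` S"
  proof (intro equalityI subsetI)
    fix B assume "B \<in> {B. shortest_minimal_generating_set f B}"
    then have B: "shortest_minimal_generating_set f B" by simp
    then have "B \<subseteq> (\<lambda>k. a * \<zeta> ^ k) ` {..<n}" "card B = 2"
      by (auto simp: shortest_iff generating_set_def complex_roots_eq_powers)
    then obtain x y where "B = {x, y}" "x \<noteq> y"
      "x \<in> (\<lambda>k. a * \<zeta> ^ k) ` {..<n}" "y \<in> (\<lambda>k. a * \<zeta> ^ k) ` {..<n}"
      by (auto simp: card_2_iff)
    then obtain i j where ij: "i < n" "j < n" "B = {a * \<zeta> ^ i, a * \<zeta> ^ j}" "i \<noteq> j" by auto
    define k l where "k = min i j" and "l = max i j"
    have kl: "k < l" "l < n" "B = {a * \<zeta> ^ k, a * \<zeta> ^ l}"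
      using ij by (auto simp: k_def l_def min_def max_def)
    then have "coprime (l - k) n" using B shortest_pair_iff by simp
    then have "(k, l) \<in> S" "B = g (k, l)" using kl by (auto simp: S_def g_def)
    then show "B \<in> g ` S" by blast
  next
    fix B assume "B \<in> g ` S"
    then show "B \<in> {B. shortest_minimal_generating_set f B}"
      using shortest_pair_iff by (auto simp: S_def g_def)
  qed
  have "inj_on g S"
  proof (rule inj_onI)
    fix x y assume xy: "x \<in> S" "y \<in> S" "g x = g y"
    obtain k l k' l' where kl: "x = (k, l)" "y = (k', l')" by fastforce
    have inj: "a * \<zeta> ^ i = a * \<zeta> ^ j \<longleftrightarrow> i = j" if "i < n" "j < n" for i j
      using inj_onD[OF inj_on_root_powers, of i j] that by auto
    have "k < l" "l < n" "k' < l'" "l' < n" using xy kl by (auto simp: S_def)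
    moreover have "{a * \<zeta> ^ k, a * \<zeta> ^ l} = {a * \<zeta> ^ k', a * \<zeta> ^ l'}"
      using xy(3) kl by (simp add: g_def)
    ultimately have "(k = k' \<and> l = l') \<or> (k = l' \<and> l = k')"
      unfolding doubleton_eq_iff by (simp only: inj less_trans[of k l n] less_trans[of k' l' n])
    then show "x = y" using \<open>k < l\<close> \<open>k' < l'\<close> kl by auto
  qed
  then have "card {B. shortest_minimal_generating_set f B} = card S"
    using eq by (simp add: card_image)
  moreover have "2 * card S = n * totient n"
    using card_coprime_difference_pairs[of n] n_gt_2 by (simp add: S_def)
  then have "2 * real (card S) = real n * real (totient n)" by (metis of_nat_mult of_nat_numeral)
  ultimately show ?thesis by simp
qed

text \<open>A prime divides the gcd exactly when it divides \<open>n\<close> and all exponents are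
  congruent to \<open>b 1\<close> modulo it; any \<open>b i - b j\<close> is a difference of two of
  the listed ones.\<close>

lemma separated_iff_Gcd:
  fixes m :: nat and b :: "nat \<Rightarrow> int"
  assumes "m \<ge> 1"
  shows "separated (b ` {1..m}) \<longleftrightarrow> Gcd (insert (int n) ((\<lambda>i. b i - b 1) ` {2..m})) = 1"
    (is "_ \<longleftrightarrow> ?g = 1")
proof
  assume sep: "separated (b ` {1..m})"
  show "?g = 1"
  proof (rule ccontr)
    assume "?g \<noteq> 1"
    moreover have "?g \<ge> 0" by simp
    ultimately have "nat ?g \<noteq> 1" by linarith
    then obtain p where p: "prime p" "p dvd nat ?g" using prime_factor_nat by blast
    then have pg: "int p dvd ?g" by (metis \<open>?g \<ge> 0\<close> int_dvd_int_iff nat_0_le)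
    then have "int p dvd int n" by (meson Gcd_dvd dvd_trans insertI1)
    then have "p dvd n" by simp
    have d: "int p dvd b i - b 1" if "i \<in> {1..m}" for i
    proof (cases "i = 1")
      case False
      then have "b i - b 1 \<in> insert (int n) ((\<lambda>i. b i - b 1) ` {2..m})" using that by auto
      then show ?thesis using pg by (meson Gcd_dvd dvd_trans)
    qed simp
    obtain x y where "x \<in> b ` {1..m}" "y \<in> b ` {1..m}" "\<not> int p dvd x - y"
      using separatedD[OF sep p(1) \<open>p dvd n\<close>] .
    then obtain i j where ij: "i \<in> {1..m}" "j \<in> {1..m}" "\<not> int p dvd b i - b j" by blast
    then show False using dvd_diff[OF d[OF ij(1)] d[OF ij(2)]] by simp
  qed
next
  assume g: "?g = 1"
  show "separated (b ` {1..m})"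
    unfolding separated_def
  proof (intro allI impI, rule ccontr)
    fix p assume p: "prime p \<and> p dvd n" and "\<not> (\<exists>x\<in>b ` {1..m}. \<exists>y\<in>b ` {1..m}. \<not> int p dvd x - y)"
    then have "int p dvd ?g" using assms by (intro Gcd_greatest) auto
    then have "int p dvd 1" by (simp only: g)
    then show False using p by simp
  qed
qed

text \<open>Minimality attaches to each index \<open>i\<close> a prime \<open>P i\<close> modulo
  which all exponents other than \<open>b i\<close> agree. If \<open>P i = P j\<close> with
  \<open>i \<noteq> j\<close>, then a third index \<open>t\<close>, available since
  \<open>m > 2\<close>, links \<open>b i\<close> and \<open>b j\<close> to the rest, so all
  exponents agree modulo that prime, contradicting separation.\<close>

lemma minimal_card_le:
  fixes m :: nat and b :: "nat \<Rightarrow> int"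
  assumes m: "m > 2" and inj: "inj_on (\<lambda>i. rt (b i)) {1..m}"
    and min: "minimal_generating_set f ((\<lambda>i. rt (b i)) ` {1..m})"
  shows "m \<le> card (prime_factors n)"
proof -
  have sep: "separated (b ` {1..m})"
    using min generating_iff_separated[of "b ` {1..m}"]
    by (simp add: minimal_generating_iff image_image)
  have "\<exists>p. prime p \<and> p dvd n \<and> (\<forall>j\<in>{1..m} - {i}. \<forall>k\<in>{1..m} - {i}. int p dvd b j - b k)"
    if i: "i \<in> {1..m}" for i
  proof -
    have "(\<lambda>i. rt (b i)) ` ({1..m} - {i}) \<subset> (\<lambda>i. rt (b i)) ` {1..m}"
    proof (rule image_strict_mono[OF inj])
      show "{1..m} - {i} \<subset> {1..m}" using i by blast
    qed
    then have "\<not> generating_set f (rt ` b ` ({1..m} - {i}))"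
      using min by (simp add: minimal_generating_iff image_image)
    then show ?thesis unfolding generating_iff_separated separated_def by blast
  qed
  then obtain P where P: "\<And>i. i \<in> {1..m} \<Longrightarrow> prime (P i) \<and> P i dvd n \<and>
    (\<forall>j\<in>{1..m} - {i}. \<forall>k\<in>{1..m} - {i}. int (P i) dvd b j - b k)" by metis
  have "inj_on P {1..m}"
  proof (rule inj_onI, rule ccontr)
    fix i j assume ij: "i \<in> {1..m}" "j \<in> {1..m}" "P i = P j" "i \<noteq> j"
    have "card {i, j} < card {1..m}" using m ij(4) by simp
    then have "\<not> {1..m} \<subseteq> {i, j}" by (metis card_mono finite.emptyI finite.insertI not_le)
    then obtain t where t: "t \<in> {1..m}" "t \<noteq> i" "t \<noteq> j" by blast
    have d: "int (P i) dvd b k - b t" if "k \<in> {1..m}" for k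
    proof (cases "k = i")
      case True
      then show ?thesis using P[OF ij(2)] t ij by auto
    next
      case False
      then show ?thesis using P[OF ij(1)] t that by auto
    qed
    have "prime (P i)" "P i dvd n" using P[OF ij(1)] by auto
    then obtain x y where "x \<in> b ` {1..m}" "y \<in> b ` {1..m}" "\<not> int (P i) dvd x - y"
      using separatedD[OF sep] by metis
    then obtain k l where kl: "k \<in> {1..m}" "l \<in> {1..m}" "\<not> int (P i) dvd b k - b l" by blast
    then show False using dvd_diff[OF d[OF kl(1)] d[OF kl(2)]] by simp
  qed
  moreover have "P ` {1..m} \<subseteq> prime_factors n"
    using P n_pos by (auto simp: in_prime_factors_iff)
  ultimately have "card {1..m} \<le> card (prime_factors n)" by (intro card_inj_on_le) auto
  then show ?thesis by simp
qed

text \<open>A prime dividing \<open>\<alpha> i\<close> divides \<open>n div \<alpha> j\<close> for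
  every \<open>j \<noteq> i\<close> but not \<open>n div \<alpha> i\<close>. So the full set of
  exponents is separated, while dropping index \<open>i\<close> leaves only multiples of that
  prime.\<close>

lemma coprime_factors_minimal:
  fixes m :: nat and \<alpha> :: "nat \<Rightarrow> nat"
  assumes m: "m \<ge> 2" and prod: "n = (\<Prod>i=1..m. \<alpha> i)"
    and gt1: "\<And>i. i \<in> {1..m} \<Longrightarrow> \<alpha> i > 1"
    and cop: "\<And>i j. i \<in> {1..m} \<Longrightarrow> j \<in> {1..m} \<Longrightarrow> i \<noteq> j \<Longrightarrow> coprime (\<alpha> i) (\<alpha> j)"
  shows "minimal_generating_set f ((\<lambda>i. a * \<zeta> ^ (n div \<alpha> i)) ` {1..m})"
proof -
  define e where "e = (\<lambda>i. int (n div \<alpha> i))"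
  have eq: "(\<lambda>i. a * \<zeta> ^ (n div \<alpha> i)) ` J = rt ` e ` J" for J
    by (simp add: e_def image_image)
  have split: "n = \<alpha> i * (\<Prod>j\<in>{1..m} - {i}. \<alpha> j)" if "i \<in> {1..m}" for i
    unfolding prod using that by (subst prod.remove[of _ i]) auto
  have div: "n div \<alpha> i = (\<Prod>j\<in>{1..m} - {i}. \<alpha> j)" if "i \<in> {1..m}" for i
    using split[OF that] gt1[OF that] by (metis nonzero_mult_div_cancel_left not_one_less_zero)
  have other: "int p dvd e j" if "p dvd \<alpha> i" "i \<in> {1..m}" "j \<in> {1..m}" "j \<noteq> i" for p i j
  proof -
    have "\<alpha> i dvd (\<Prod>j\<in>{1..m} - {j}. \<alpha> j)" using that by (intro dvd_prodI) auto
    then show ?thesis using that div unfolding e_def by (metis dvd_trans int_dvd_int_iff)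
  qed
  have self: "\<not> int p dvd e i" if p: "prime p" "p dvd \<alpha> i" "i \<in> {1..m}" for p i
  proof
    assume "int p dvd e i"
    then have "p dvd (\<Prod>j\<in>{1..m} - {i}. \<alpha> j)"
      unfolding e_def int_dvd_int_iff div[OF p(3)] .
    then have "\<exists>j\<in>{1..m} - {i}. p dvd \<alpha> j"
      using p(1) by (simp only: prime_dvd_prod_iff finite_atLeastAtMost finite_Diff)
    then obtain j where "j \<in> {1..m} - {i}" "p dvd \<alpha> j" by blast
    then show False using p cop[of i j] by (metis DiffD1 DiffD2 coprime_common_divisor
          insertI1 not_prime_unit)
  qed
  have "separated (e ` {1..m})"
    unfolding separated_def
  proof (intro allI impI)
    fix p assume p: "prime p \<and> p dvd n"
    then have "\<exists>i\<in>{1..m}. p dvd \<alpha> i"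
      using prime_dvd_prod_iff[of "{1..m}" p \<alpha>] prod by auto
    then obtain i where i: "i \<in> {1..m}" "p dvd \<alpha> i" by blast
    obtain j where j: "j \<in> {1..m}" "j \<noteq> i"
      using m by (cases "i = 1") (auto intro: that[of 1] that[of 2])
    have "\<not> int p dvd e i - e j"
      using other[OF i(2,1) j] self[of p i] i p by (metis diff_add_cancel dvd_add)
    then show "\<exists>x\<in>e ` {1..m}. \<exists>y\<in>e ` {1..m}. \<not> int p dvd x - y" using i j by blast
  qed
  then have gen: "generating_set f (rt ` e ` {1..m})" by (simp add: generating_iff_separated)
  have "\<not> generating_set f A" if A: "A \<subset> rt ` e ` {1..m}" for A
  proof
    assume "generating_set f A"
    \<comment> \<open>A proper subset misses some root, so its exponents can be chosen among those
      of the other indices.\<close>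
    obtain i where i: "i \<in> {1..m}" "rt (e i) \<notin> A" using A by blast
    then have "A \<subseteq> rt ` e ` ({1..m} - {i})" using A by blast
    then obtain B where B: "B \<subseteq> e ` ({1..m} - {i})" "A = rt ` B" by (auto elim: subset_imageE)
    then have sep: "separated B" using \<open>generating_set f A\<close> generating_iff_separated by blast
    obtain p where p: "prime p" "p dvd \<alpha> i" using gt1[OF i(1)] prime_factor_nat[of "\<alpha> i"] by auto
    then have "p dvd n" using split[OF i(1)] by (metis dvd_mult2)
    then obtain b b' where b: "b \<in> B" "b' \<in> B" "\<not> int p dvd b - b'" using separatedD[OF sep p(1)] by blast
    have "int p dvd x" if "x \<in> B" for x
    proof -
      obtain j where "j \<in> {1..m}" "j \<noteq> i" "x = e j" using \<open>x \<in> B\<close> B(1) by blast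
      then show ?thesis using other[OF p(2) i(1)] by blast
    qed
    then show False using b by (meson dvd_diff)
  qed
  then show ?thesis using gen unfolding eq minimal_generating_iff by blast
qed

end

theorem lemma2p12:
  fixes n :: nat and c :: rat and \<zeta> a :: complex and f :: "rat Polynomial.poly"
  assumes "n > 2" and "odd n"
    and "primitive_root_of_unity n \<zeta>"
    and "c > 0"
    and "f = Polynomial.monom 1 n - [:c:]"
    and "Factorial_Ring.irreducible f"
    and "a = complex_of_real (root n (of_rat c))"
  shows
    "(\<forall>(m::nat) (b :: nat \<Rightarrow> int). m \<ge> 1 \<longrightarrow>
        (generating_set f ((\<lambda>i. a * \<zeta> powi b i) ` {1..m}) \<longleftrightarrow>
         Gcd (insert (int n) ((\<lambda>i. b i - b 1) ` {2..m})) = 1))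
   \<and> (\<forall>k l :: nat. k < l \<and> l \<le> n - 1 \<longrightarrow>
        (shortest_minimal_generating_set f {a * \<zeta> ^ k, a * \<zeta> ^ l} \<longleftrightarrow> gcd (l - k) n = 1))
   \<and> real (card {B. shortest_minimal_generating_set f B}) = real n * real (totient n) / 2
   \<and> (\<forall>(m::nat) (b :: nat \<Rightarrow> int). m > 2 \<and> inj_on (\<lambda>i. a * \<zeta> powi b i) {1..m} \<and>
        minimal_generating_set f ((\<lambda>i. a * \<zeta> powi b i) ` {1..m}) \<longrightarrow>
        m \<le> card (prime_factors n))
   \<and> (\<forall>(m::nat) (\<alpha> :: nat \<Rightarrow> nat). m \<ge> 2 \<and> n = (\<Prod>i=1..m. \<alpha> i) \<and>
        (\<forall>i\<in>{1..m}. \<alpha> i > 1) \<and>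
        (\<forall>i\<in>{1..m}. \<forall>j\<in>{1..m}. i \<noteq> j \<longrightarrow> coprime (\<alpha> i) (\<alpha> j)) \<longrightarrow>
        minimal_generating_set f ((\<lambda>i. a * \<zeta> ^ (n div \<alpha> i)) ` {1..m}))"
proof -
  interpret odd_radical n c \<zeta> a f
    using assms by unfold_locales
  show ?thesis
  proof (intro conjI allI impI)
    fix m :: nat and b :: "nat \<Rightarrow> int"
    assume "m \<ge> 1"
    then show "generating_set f ((\<lambda>i. a * \<zeta> powi b i) ` {1..m}) \<longleftrightarrow>
        Gcd (insert (int n) ((\<lambda>i. b i - b 1) ` {2..m})) = 1"
      using separated_iff_Gcd[of m b] generating_iff_separated[of "b ` {1..m}"]
      by (simp add: image_image)
  next
    fix k l :: nat
    assume "k < l \<and> l \<le> n - 1"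
    then have "k < l" "l < n" using n_pos by auto
    then show "shortest_minimal_generating_set f {a * \<zeta> ^ k, a * \<zeta> ^ l} \<longleftrightarrow> gcd (l - k) n = 1"
      using shortest_pair_iff by (simp only: coprime_iff_gcd_eq_1)
  next
    show "real (card {B. shortest_minimal_generating_set f B}) = real n * real (totient n) / 2"
      by (rule card_shortest)
  next
    fix m :: nat and b :: "nat \<Rightarrow> int"
    assume "m > 2 \<and> inj_on (\<lambda>i. a * \<zeta> powi b i) {1..m} \<and>
      minimal_generating_set f ((\<lambda>i. a * \<zeta> powi b i) ` {1..m})"
    then show "m \<le> card (prime_factors n)" by (intro minimal_card_le) auto
  next
    fix m :: nat and \<alpha> :: "nat \<Rightarrow> nat"
    assume "m \<ge> 2 \<and> n = (\<Prod>i=1..m. \<alpha> i) \<and> (\<forall>i\<in>{1..m}. \<alpha> i > 1) \<and>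
      (\<forall>i\<in>{1..m}. \<forall>j\<in>{1..m}. i \<noteq> j \<longrightarrow> coprime (\<alpha> i) (\<alpha> j))"
    then show "minimal_generating_set f ((\<lambda>i. a * \<zeta> ^ (n div \<alpha> i)) ` {1..m})"
      by (intro coprime_factors_minimal) auto
  qed
qed

end
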